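(* Let $M|N$ be a biseparable ring extension of depth two (D2). Then $M|N$ is a QF (quasi-Frobenius) extension, i.e. both left QF and right QF.
   Context: A ring extension $M|N$ is a unital ring homomorphism $N\to M$. It is D2 if $M\otimes_NM$ is isomorphic to a direct summand of $\oplus^n\,{}_NM_M$ as an $N$-$M$-bimodule for some $n\ge1$ (left D2) and to a direct summand of $\oplus^m\,{}_MM_N$ as an $M$-$N$-bimodule for some $m\ge1$ (right D2). It is biseparable if $M_N$ and ${}_NM$ are finitely generated projective, $M|N$ is a separable extension (the multiplication map $M\otimes_NM\to M$ is a split $M$-$M$-bimodule epimorphism) and a split extension ($M\cong N\oplus V$ as $N$-bimodules for some $N$-bimodule $V$). $M|N$ is left QF if $M_N$ and ${}_NM$ are finitely generated projective and the $N$-$M$-bimodule $M^*=\mathrm{Hom}(M_N,N_N)$ is isomorphic to a direct summand of $\oplus^k\,{}_NM_M$ for some $k\ge 1$; right QF if $M_N$ and ${}_NM$ are finitely generated projective and the $M$-$N$-bimodule ${}^*M=\mathrm{Hom}({}_NM,{}_NN)$ is isomorphic to a direct summand of $\oplus^k\,{}_MM_N$ for some $k\ge 1$. *)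

theory Defs
  imports "HOL-Algebra.Free_Abelian_Groups" "HOL-Algebra.RingHom"
begin

section \<open>Modules and bimodules over possibly noncommutative rings\<close>

text \<open>HOL-Algebra's \<open>module\<close> needs a commutative ring. As there, only the additive
  structure of the underlying ring record is used; its \<open>mult\<close> and \<open>one\<close> are junk.
  One-sided modules use the same record and ignore the other action.\<close>

record ('r, 's, 'a) bimod = "'a ring" +
  lact :: "'r \<Rightarrow> 'a \<Rightarrow> 'a"
  ract :: "'a \<Rightarrow> 's \<Rightarrow> 'a"

locale left_module =
  fixes R :: "('r, 'k) ring_scheme" (structure) and A :: "('r, 's, 'a) bimod"
  assumes left_ring: "ring R" and left_abelian_group: "abelian_group A"
    and lact_closed: "\<lbrakk>r \<in> carrier R; x \<in> carrier A\<rbrakk> \<Longrightarrow> lact A r x \<in> carrier A"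
    and lact_add_right: "\<lbrakk>r \<in> carrier R; x \<in> carrier A; y \<in> carrier A\<rbrakk>
      \<Longrightarrow> lact A r (x \<oplus>\<^bsub>A\<^esub> y) = lact A r x \<oplus>\<^bsub>A\<^esub> lact A r y"
    and lact_add_left: "\<lbrakk>r \<in> carrier R; r' \<in> carrier R; x \<in> carrier A\<rbrakk>
      \<Longrightarrow> lact A (r \<oplus> r') x = lact A r x \<oplus>\<^bsub>A\<^esub> lact A r' x"
    and lact_assoc: "\<lbrakk>r \<in> carrier R; r' \<in> carrier R; x \<in> carrier A\<rbrakk>
      \<Longrightarrow> lact A (r \<otimes> r') x = lact A r (lact A r' x)"
    and lact_one: "x \<in> carrier A \<Longrightarrow> lact A \<one> x = x"

locale right_module =
  fixes S :: "('s, 'k) ring_scheme" (structure) and A :: "('r, 's, 'a) bimod"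
  assumes right_ring: "ring S" and right_abelian_group: "abelian_group A"
    and ract_closed: "\<lbrakk>s \<in> carrier S; x \<in> carrier A\<rbrakk> \<Longrightarrow> ract A x s \<in> carrier A"
    and ract_add_left: "\<lbrakk>s \<in> carrier S; x \<in> carrier A; y \<in> carrier A\<rbrakk>
      \<Longrightarrow> ract A (x \<oplus>\<^bsub>A\<^esub> y) s = ract A x s \<oplus>\<^bsub>A\<^esub> ract A y s"
    and ract_add_right: "\<lbrakk>s \<in> carrier S; s' \<in> carrier S; x \<in> carrier A\<rbrakk>
      \<Longrightarrow> ract A x (s \<oplus> s') = ract A x s \<oplus>\<^bsub>A\<^esub> ract A x s'"
    and ract_assoc: "\<lbrakk>s \<in> carrier S; s' \<in> carrier S; x \<in> carrier A\<rbrakk>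
      \<Longrightarrow> ract A x (s \<otimes> s') = ract A (ract A x s) s'"
    and ract_one: "x \<in> carrier A \<Longrightarrow> ract A x \<one> = x"

locale bimodule = left_module R A + right_module S A
  for R :: "('r, 'k) ring_scheme" and S :: "('s, 'l) ring_scheme"
    and A :: "('r, 's, 'a) bimod" +
  assumes lact_ract: "\<lbrakk>r \<in> carrier R; s \<in> carrier S; x \<in> carrier A\<rbrakk>
    \<Longrightarrow> ract A (lact A r x) s = lact A r (ract A x s)"

definition left_hom ::
  "('r, 'k) ring_scheme \<Rightarrow> ('r, 's, 'a) bimod \<Rightarrow> ('r, 't, 'b) bimod \<Rightarrow> ('a \<Rightarrow> 'b) set" where
  "left_hom R A B = {h \<in> hom (add_monoid A) (add_monoid B).
     \<forall>r\<in>carrier R. \<forall>x\<in>carrier A. h (lact A r x) = lact B r (h x)}"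

definition right_hom ::
  "('s, 'k) ring_scheme \<Rightarrow> ('r, 's, 'a) bimod \<Rightarrow> ('t, 's, 'b) bimod \<Rightarrow> ('a \<Rightarrow> 'b) set" where
  "right_hom S A B = {h \<in> hom (add_monoid A) (add_monoid B).
     \<forall>s\<in>carrier S. \<forall>x\<in>carrier A. h (ract A x s) = ract B (h x) s}"

definition bimod_hom ::
  "('r, 'k) ring_scheme \<Rightarrow> ('s, 'l) ring_scheme \<Rightarrow>
   ('r, 's, 'a) bimod \<Rightarrow> ('r, 's, 'b) bimod \<Rightarrow> ('a \<Rightarrow> 'b) set" where
  "bimod_hom R S A B = left_hom R A B \<inter> right_hom S A B"

definition bimod_isomorphic ::
  "('r, 'k) ring_scheme \<Rightarrow> ('s, 'l) ring_scheme \<Rightarrow>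
   ('r, 's, 'a) bimod \<Rightarrow> ('r, 's, 'b) bimod \<Rightarrow> bool" where
  "bimod_isomorphic R S A B \<longleftrightarrow>
     (\<exists>h\<in>bimod_hom R S A B. bij_betw h (carrier A) (carrier B))"

definition left_submodule ::
  "('r, 'k) ring_scheme \<Rightarrow> 'a set \<Rightarrow> ('r, 's, 'a) bimod \<Rightarrow> bool" where
  "left_submodule R P A \<longleftrightarrow>
     additive_subgroup P A \<and> (\<forall>r\<in>carrier R. \<forall>x\<in>P. lact A r x \<in> P)"

definition right_submodule ::
  "('s, 'k) ring_scheme \<Rightarrow> 'a set \<Rightarrow> ('r, 's, 'a) bimod \<Rightarrow> bool" where
  "right_submodule S P A \<longleftrightarrow>
     additive_subgroup P A \<and> (\<forall>s\<in>carrier S. \<forall>x\<in>P. ract A x s \<in> P)"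

definition sub_bimodule ::
  "('r, 'k) ring_scheme \<Rightarrow> ('s, 'l) ring_scheme \<Rightarrow> 'a set \<Rightarrow> ('r, 's, 'a) bimod \<Rightarrow> bool" where
  "sub_bimodule R S P A \<longleftrightarrow> left_submodule R P A \<and> right_submodule S P A"

definition internal_sum :: "('a, 'm) ring_scheme \<Rightarrow> 'a set \<Rightarrow> 'a set \<Rightarrow> bool" where
  "internal_sum B P Q \<longleftrightarrow> P \<inter> Q = {\<zero>\<^bsub>B\<^esub>} \<and> P <+>\<^bsub>B\<^esub> Q = carrier B"

text \<open>\<open>A\<close> is isomorphic to a direct summand of \<open>B\<close>, as left modules, right modules and
  bimodules.\<close>

definition left_summand ::
  "('r, 'k) ring_scheme \<Rightarrow> ('r, 's, 'a) bimod \<Rightarrow> ('r, 't, 'b) bimod \<Rightarrow> bool" where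
  "left_summand R A B \<longleftrightarrow>
     (\<exists>P Q. left_submodule R P B \<and> left_submodule R Q B \<and> internal_sum B P Q \<and>
       (\<exists>h\<in>left_hom R A B. bij_betw h (carrier A) P))"

definition right_summand ::
  "('s, 'k) ring_scheme \<Rightarrow> ('r, 's, 'a) bimod \<Rightarrow> ('t, 's, 'b) bimod \<Rightarrow> bool" where
  "right_summand S A B \<longleftrightarrow>
     (\<exists>P Q. right_submodule S P B \<and> right_submodule S Q B \<and> internal_sum B P Q \<and>
       (\<exists>h\<in>right_hom S A B. bij_betw h (carrier A) P))"

definition bimod_summand ::
  "('r, 'k) ring_scheme \<Rightarrow> ('s, 'l) ring_scheme \<Rightarrow>
   ('r, 's, 'a) bimod \<Rightarrow> ('r, 's, 'b) bimod \<Rightarrow> bool" where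
  "bimod_summand R S A B \<longleftrightarrow>
     (\<exists>P Q. sub_bimodule R S P B \<and> sub_bimodule R S Q B \<and> internal_sum B P Q \<and>
       (\<exists>h\<in>bimod_hom R S A B. bij_betw h (carrier A) P))"


section \<open>Constructions\<close>

text \<open>The ring \<open>M\<close> as a bimodule via ring homomorphisms \<open>f\<close> and \<open>g\<close> into \<open>M\<close>.\<close>

definition ring_bimod ::
  "('a, 'k) ring_scheme \<Rightarrow> ('r \<Rightarrow> 'a) \<Rightarrow> ('s \<Rightarrow> 'a) \<Rightarrow> ('r, 's, 'a) bimod" where
  "ring_bimod M f g =
     \<lparr>carrier = carrier M, mult = mult M, one = one M, zero = zero M, add = add M,
      lact = (\<lambda>r x. f r \<otimes>\<^bsub>M\<^esub> x), ract = (\<lambda>x s. x \<otimes>\<^bsub>M\<^esub> g s)\<rparr>"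

definition bimod_sum ::
  "('r, 's, 'a) bimod \<Rightarrow> ('r, 's, 'b) bimod \<Rightarrow> ('r, 's, 'a \<times> 'b) bimod" where
  "bimod_sum A B =
     \<lparr>carrier = carrier A \<times> carrier B, mult = undefined, one = undefined,
      zero = (\<zero>\<^bsub>A\<^esub>, \<zero>\<^bsub>B\<^esub>), add = (\<lambda>(a, b) (a', b'). (a \<oplus>\<^bsub>A\<^esub> a', b \<oplus>\<^bsub>B\<^esub> b')),
      lact = (\<lambda>r (a, b). (lact A r a, lact B r b)),
      ract = (\<lambda>(a, b) s. (ract A a s, ract B b s))\<rparr>"

text \<open>The direct sum of copies of \<open>A\<close> indexed by a possibly infinite set \<open>I\<close>.\<close>

definition copies :: "'i set \<Rightarrow> ('r, 's, 'a) bimod \<Rightarrow> ('r, 's, 'i \<Rightarrow> 'a) bimod" where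
  "copies I A =
     \<lparr>carrier = {x \<in> I \<rightarrow>\<^sub>E carrier A. finite {i \<in> I. x i \<noteq> \<zero>\<^bsub>A\<^esub>}},
      mult = undefined, one = undefined,
      zero = (\<lambda>i\<in>I. \<zero>\<^bsub>A\<^esub>), add = (\<lambda>x y. \<lambda>i\<in>I. x i \<oplus>\<^bsub>A\<^esub> y i),
      lact = (\<lambda>r x. \<lambda>i\<in>I. lact A r (x i)),
      ract = (\<lambda>x s. \<lambda>i\<in>I. ract A (x i) s)\<rparr>"

text \<open>The tensor product of a right and a left \<open>S\<close>-module: the free abelian group on pairs
  modulo the subgroup generated by the balancing relations. Its elements are cosets; the
  actions are computed on representatives.\<close>

definition tensor_free ::
  "('r, 's, 'a) bimod \<Rightarrow> ('s, 't, 'b) bimod \<Rightarrow> ('a \<times> 'b \<Rightarrow>\<^sub>0 int) monoid" where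
  "tensor_free A B = free_Abelian_group (carrier A \<times> carrier B)"

definition tensor_rels ::
  "('s, 'k) ring_scheme \<Rightarrow> ('r, 's, 'a) bimod \<Rightarrow> ('s, 't, 'b) bimod \<Rightarrow> ('a \<times> 'b \<Rightarrow>\<^sub>0 int) set" where
  "tensor_rels S A B = generate (tensor_free A B)
     ({frag_of (a \<oplus>\<^bsub>A\<^esub> a', b) - frag_of (a, b) - frag_of (a', b) | a a' b.
         a \<in> carrier A \<and> a' \<in> carrier A \<and> b \<in> carrier B} \<union>
      {frag_of (a, b \<oplus>\<^bsub>B\<^esub> b') - frag_of (a, b) - frag_of (a, b') | a b b'.
         a \<in> carrier A \<and> b \<in> carrier B \<and> b' \<in> carrier B} \<union>
      {frag_of (ract A a s, b) - frag_of (a, lact B s b) | a s b.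
         a \<in> carrier A \<and> s \<in> carrier S \<and> b \<in> carrier B})"

definition tensor ::
  "('s, 'k) ring_scheme \<Rightarrow> ('r, 's, 'a) bimod \<Rightarrow> ('s, 't, 'b) bimod \<Rightarrow>
   ('r, 't, ('a \<times> 'b \<Rightarrow>\<^sub>0 int) set) bimod" where
  "tensor S A B = (let F = tensor_free A B; K = tensor_rels S A B in
     \<lparr>carrier = carrier (F Mod K), mult = undefined, one = undefined,
      zero = \<one>\<^bsub>F Mod K\<^esub>, add = (\<otimes>\<^bsub>F Mod K\<^esub>),
      lact = (\<lambda>r X. \<Union>c\<in>X. K #>\<^bsub>F\<^esub> frag_extend (\<lambda>(a, b). frag_of (lact A r a, b)) c),
      ract = (\<lambda>X t. \<Union>c\<in>X. K #>\<^bsub>F\<^esub> frag_extend (\<lambda>(a, b). frag_of (a, ract B b t)) c)\<rparr>)"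

text \<open>For an \<open>R\<close>-\<open>S\<close>-bimodule \<open>A\<close>, the \<open>S\<close>-\<open>R\<close>-bimodules \<open>Hom(A\<^sub>S, S\<^sub>S)\<close>, with
  \<open>(s \<phi> r)(x) = s \<phi>(r x)\<close>, and \<open>Hom(\<^sub>RA, \<^sub>RR)\<close>, with \<open>(s \<phi> r)(x) = \<phi>(x s) r\<close>.
  The maps are made extensional so that equality means equality on \<open>carrier A\<close>.\<close>

definition right_dual ::
  "('s, 'k) ring_scheme \<Rightarrow> ('r, 's, 'a) bimod \<Rightarrow> ('s, 'r, 'a \<Rightarrow> 's) bimod" where
  "right_dual S A =
     \<lparr>carrier = right_hom S A (ring_bimod S id id) \<inter> extensional (carrier A),
      mult = undefined, one = undefined,
      zero = (\<lambda>x\<in>carrier A. \<zero>\<^bsub>S\<^esub>), add = (\<lambda>\<phi> \<psi>. \<lambda>x\<in>carrier A. \<phi> x \<oplus>\<^bsub>S\<^esub> \<psi> x),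
      lact = (\<lambda>s \<phi>. \<lambda>x\<in>carrier A. s \<otimes>\<^bsub>S\<^esub> \<phi> x),
      ract = (\<lambda>\<phi> r. \<lambda>x\<in>carrier A. \<phi> (lact A r x))\<rparr>"

definition left_dual ::
  "('r, 'k) ring_scheme \<Rightarrow> ('r, 's, 'a) bimod \<Rightarrow> ('s, 'r, 'a \<Rightarrow> 'r) bimod" where
  "left_dual R A =
     \<lparr>carrier = left_hom R A (ring_bimod R id id) \<inter> extensional (carrier A),
      mult = undefined, one = undefined,
      zero = (\<lambda>x\<in>carrier A. \<zero>\<^bsub>R\<^esub>), add = (\<lambda>\<phi> \<psi>. \<lambda>x\<in>carrier A. \<phi> x \<oplus>\<^bsub>R\<^esub> \<psi> x),
      lact = (\<lambda>s \<phi>. \<lambda>x\<in>carrier A. \<phi> (ract A x s)),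
      ract = (\<lambda>\<phi> r. \<lambda>x\<in>carrier A. \<phi> x \<otimes>\<^bsub>R\<^esub> r)\<rparr>"


section \<open>Finitely generated projective modules\<close>

definition left_finitely_generated ::
  "('r, 'k) ring_scheme \<Rightarrow> ('r, 's, 'a) bimod \<Rightarrow> bool" where
  "left_finitely_generated R A \<longleftrightarrow>
     (\<exists>G. finite G \<and> G \<subseteq> carrier A \<and>
       (\<forall>x\<in>carrier A. \<exists>c\<in>G \<rightarrow> carrier R. x = (\<Oplus>\<^bsub>A\<^esub>g\<in>G. lact A (c g) g)))"

definition right_finitely_generated ::
  "('s, 'k) ring_scheme \<Rightarrow> ('r, 's, 'a) bimod \<Rightarrow> bool" where
  "right_finitely_generated S A \<longleftrightarrow>
     (\<exists>G. finite G \<and> G \<subseteq> carrier A \<and>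
       (\<forall>x\<in>carrier A. \<exists>c\<in>G \<rightarrow> carrier S. x = (\<Oplus>\<^bsub>A\<^esub>g\<in>G. ract A g (c g))))"

text \<open>Projective: isomorphic to a direct summand of a free module. Taking bases in the
  element type of \<open>A\<close> loses nothing, since a projective module is a direct summand of the
  free module on its own elements.\<close>

definition left_projective :: "('r, 'k) ring_scheme \<Rightarrow> ('r, 's, 'a) bimod \<Rightarrow> bool" where
  "left_projective R A \<longleftrightarrow>
     (\<exists>I :: 'a set. left_summand R A (copies I (ring_bimod R id id)))"

definition right_projective :: "('s, 'k) ring_scheme \<Rightarrow> ('r, 's, 'a) bimod \<Rightarrow> bool" where
  "right_projective S A \<longleftrightarrow>
     (\<exists>I :: 'a set. right_summand S A (copies I (ring_bimod S id id)))"


section \<open>Ring extensions\<close>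

text \<open>A (not necessarily injective) ring extension \<open>M|N\<close> is given by \<open>ring_hom_ring N M f\<close>; HOL-Algebra's ring
  homomorphisms are unital.\<close>

definition fgp_extension ::
  "('n, 'k) ring_scheme \<Rightarrow> ('m, 'l) ring_scheme \<Rightarrow> ('n \<Rightarrow> 'm) \<Rightarrow> bool" where
  "fgp_extension N M f \<longleftrightarrow>
     right_finitely_generated N (ring_bimod M f f) \<and> right_projective N (ring_bimod M f f) \<and>
     left_finitely_generated N (ring_bimod M f f) \<and> left_projective N (ring_bimod M f f)"

definition left_D2 ::
  "('n, 'k) ring_scheme \<Rightarrow> ('m, 'l) ring_scheme \<Rightarrow> ('n \<Rightarrow> 'm) \<Rightarrow> bool" where
  "left_D2 N M f \<longleftrightarrow>
     (\<exists>n::nat. n \<ge> 1 \<and>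
       bimod_summand N M (tensor N (ring_bimod M f f) (ring_bimod M f id))
         (copies {..<n} (ring_bimod M f id)))"

definition right_D2 ::
  "('n, 'k) ring_scheme \<Rightarrow> ('m, 'l) ring_scheme \<Rightarrow> ('n \<Rightarrow> 'm) \<Rightarrow> bool" where
  "right_D2 N M f \<longleftrightarrow>
     (\<exists>n::nat. n \<ge> 1 \<and>
       bimod_summand M N (tensor N (ring_bimod M id f) (ring_bimod M f f))
         (copies {..<n} (ring_bimod M id f)))"

definition depth_two ::
  "('n, 'k) ring_scheme \<Rightarrow> ('m, 'l) ring_scheme \<Rightarrow> ('n \<Rightarrow> 'm) \<Rightarrow> bool" where
  "depth_two N M f \<longleftrightarrow> left_D2 N M f \<and> right_D2 N M f"

text \<open>The multiplication map on \<open>M \<otimes>\<^sub>N M\<close>; all representatives of a coset have the same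
  image.\<close>

definition mult_map ::
  "('m, 'l) ring_scheme \<Rightarrow> ('m \<times> 'm \<Rightarrow>\<^sub>0 int) set \<Rightarrow> 'm" where
  "mult_map M X = the_elem
     ((\<lambda>c. \<Oplus>\<^bsub>M\<^esub>p\<in>Poly_Mapping.keys c.
        [Poly_Mapping.lookup c p] \<cdot>\<^bsub>M\<^esub> (fst p \<otimes>\<^bsub>M\<^esub> snd p)) ` X)"

definition separable_extension ::
  "('n, 'k) ring_scheme \<Rightarrow> ('m, 'l) ring_scheme \<Rightarrow> ('n \<Rightarrow> 'm) \<Rightarrow> bool" where
  "separable_extension N M f \<longleftrightarrow>
     (\<exists>\<sigma>\<in>bimod_hom M M (ring_bimod M id id)
            (tensor N (ring_bimod M id f) (ring_bimod M f id)).
       \<forall>x\<in>carrier M. mult_map M (\<sigma> x) = x)"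

text \<open>The complement \<open>V\<close> embeds into \<open>M\<close>, so its elements may be taken from the type of \<open>M\<close>.\<close>

definition split_extension ::
  "('n, 'k) ring_scheme \<Rightarrow> ('m, 'l) ring_scheme \<Rightarrow> ('n \<Rightarrow> 'm) \<Rightarrow> bool" where
  "split_extension N M f \<longleftrightarrow>
     (\<exists>V :: ('n, 'n, 'm) bimod. bimodule N N V \<and>
       bimod_isomorphic N N (ring_bimod M f f) (bimod_sum (ring_bimod N id id) V))"

definition biseparable ::
  "('n, 'k) ring_scheme \<Rightarrow> ('m, 'l) ring_scheme \<Rightarrow> ('n \<Rightarrow> 'm) \<Rightarrow> bool" where
  "biseparable N M f \<longleftrightarrow>
     fgp_extension N M f \<and> separable_extension N M f \<and> split_extension N M f"

definition left_QF ::
  "('n, 'k) ring_scheme \<Rightarrow> ('m, 'l) ring_scheme \<Rightarrow> ('n \<Rightarrow> 'm) \<Rightarrow> bool" where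
  "left_QF N M f \<longleftrightarrow> fgp_extension N M f \<and>
     (\<exists>k::nat. k \<ge> 1 \<and>
       bimod_summand N M (right_dual N (ring_bimod M id f))
         (copies {..<k} (ring_bimod M f id)))"

definition right_QF ::
  "('n, 'k) ring_scheme \<Rightarrow> ('m, 'l) ring_scheme \<Rightarrow> ('n \<Rightarrow> 'm) \<Rightarrow> bool" where
  "right_QF N M f \<longleftrightarrow> fgp_extension N M f \<and>
     (\<exists>k::nat. k \<ge> 1 \<and>
       bimod_summand M N (left_dual N (ring_bimod M f id))
         (copies {..<k} (ring_bimod M id f)))"

definition QF_extension ::
  "('n, 'k) ring_scheme \<Rightarrow> ('m, 'l) ring_scheme \<Rightarrow> ('n \<Rightarrow> 'm) \<Rightarrow> bool" where
  "QF_extension N M f \<longleftrightarrow> left_QF N M f \<and> right_QF N M f"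

end

theory Submission
  imports Defs
begin

text \<open>Left depth two provides \<open>t\<^sub>i \<in> (M \<otimes>\<^sub>N M)\<^sup>N\<close> and \<open>\<beta>\<^sub>i \<in> End(\<^sub>NM\<^sub>N)\<close> with
  \<open>x \<otimes> y = \<Sum>\<^sub>i t\<^sub>i \<beta>\<^sub>i(x) y\<close>; separability provides \<open>e \<in> M \<otimes>\<^sub>N M\<close> with \<open>x e = e x\<close> and
  product \<open>1\<close>; splitness provides an \<open>N\<close>-bimodule map \<open>E : M \<rightarrow> N\<close> and an element \<open>z \<in> M\<^sup>N\<close> with
  \<open>E(z) = 1\<close>. The chain of \<open>N\<close>-\<open>M\<close>-bimodule summands behind left QF is the following. Splitness
  makes \<open>M\<^sup>*\<close> a summand of \<open>\<E> = End(M\<^sub>N)\<close> via \<open>\<phi> \<mapsto> z \<phi>(-)\<close>; separability makes \<open>\<E>\<close> a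
  summand of \<open>\<E> \<otimes>\<^sub>N M\<close>; depth two, which makes \<open>\<E>\<close> a summand of copies of \<open>M\<close> as an
  \<open>M\<close>-\<open>N\<close>-bimodule, makes \<open>\<E> \<otimes>\<^sub>N M\<close> a summand of copies of \<open>M \<otimes>\<^sub>N M\<close>, and this, by depth
  two again, is a summand of copies of \<open>\<^sub>NM\<^sub>M\<close>. Composing these maps gives
  explicit formulas for \<open>U\<^sub>i\<^sub>l : M\<^sup>* \<rightarrow> M\<close> and \<open>V\<^sub>i\<^sub>l : M \<rightarrow> M\<^sup>*\<close> with \<open>\<Sum>\<^sub>i\<^sub>l V\<^sub>i\<^sub>l U\<^sub>i\<^sub>l = id\<close>, which are
  verified by direct computation. Right QF is left QF for the opposite rings.\<close>

section \<open>Sums over lists\<close>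

text \<open>Tensors will be represented by lists of pairs in which a pair may recur, so sums are
  indexed by lists. Being a plain fold, this sum obeys congruence and reindexing along
  \<open>map\<close> without any membership in the carrier.\<close>

definition list_sum :: "('a, 'k) ring_scheme \<Rightarrow> ('i \<Rightarrow> 'a) \<Rightarrow> 'i list \<Rightarrow> 'a" where
  "list_sum G b xs = foldr (\<lambda>x s. b x \<oplus>\<^bsub>G\<^esub> s) xs \<zero>\<^bsub>G\<^esub>"

lemma list_sum_Nil [simp]: "list_sum G b [] = \<zero>\<^bsub>G\<^esub>"
  by (simp add: list_sum_def)

lemma list_sum_Cons [simp]: "list_sum G b (x # xs) = b x \<oplus>\<^bsub>G\<^esub> list_sum G b xs"
  by (simp add: list_sum_def)

lemma list_sum_map [simp]: "list_sum G b (map g xs) = list_sum G (\<lambda>x. b (g x)) xs"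
  by (induction xs) auto

lemma list_sum_cong:
  assumes "\<And>x. x \<in> set xs \<Longrightarrow> b x = b' x"
  shows "list_sum G b xs = list_sum G b' xs"
  using assms by (induction xs) auto

text \<open>Gives the simplifier the already simplified fact \<open>x \<in> set ys\<close> under the
  sum (for \<open>[0..<k]\<close> it becomes a bound on the index), so that closure conditions on
  the summands can be discharged.\<close>

lemma list_sum_cong_simp [cong]:
  assumes "xs = ys" "\<And>x. x \<in> set ys =simp=> b x = b' x"
  shows "list_sum G b xs = list_sum G b' ys"
  using assms list_sum_cong[of ys b b' G] by (simp add: simp_implies_def)

context abelian_group
begin

lemma list_sum_closed [simp, intro]:
  "(\<And>x. x \<in> set xs \<Longrightarrow> b x \<in> carrier G) \<Longrightarrow> list_sum G b xs \<in> carrier G"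
  by (induction xs) auto

lemma list_sum_append:
  assumes "\<And>x. x \<in> set xs \<union> set ys \<Longrightarrow> b x \<in> carrier G"
  shows "list_sum G b (xs @ ys) = list_sum G b xs \<oplus> list_sum G b ys"
  using assms by (induction xs) (auto simp: a_assoc)

lemma list_sum_concat:
  assumes "\<And>xs x. xs \<in> set xss \<Longrightarrow> x \<in> set xs \<Longrightarrow> b x \<in> carrier G"
  shows "list_sum G b (concat xss) = list_sum G (list_sum G b) xss"
  using assms
proof (induction xss)
  case (Cons xs xss)
  then have "list_sum G b (xs @ concat xss) = list_sum G b xs \<oplus> list_sum G b (concat xss)"
    by (intro list_sum_append) auto
  moreover have "list_sum G b (concat xss) = list_sum G (list_sum G b) xss"
    using Cons by auto
  ultimately show ?case by simp
qed simp

lemma list_sum_product: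
  assumes "\<And>x y. x \<in> set xs \<Longrightarrow> y \<in> set ys \<Longrightarrow> b (x, y) \<in> carrier G"
  shows "list_sum G b (List.product xs ys) = list_sum G (\<lambda>x. list_sum G (\<lambda>y. b (x, y)) ys) xs"
  using assms
proof (induction xs)
  case (Cons x xs)
  then have "list_sum G b (map (Pair x) ys @ List.product xs ys)
      = list_sum G b (map (Pair x) ys) \<oplus> list_sum G b (List.product xs ys)"
    by (intro list_sum_append) auto
  then show ?case using Cons by simp
qed simp

lemma list_sum_add:
  assumes "\<And>x. x \<in> set xs \<Longrightarrow> b x \<in> carrier G" "\<And>x. x \<in> set xs \<Longrightarrow> c x \<in> carrier G"
  shows "list_sum G (\<lambda>x. b x \<oplus> c x) xs = list_sum G b xs \<oplus> list_sum G c xs"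
  using assms by (induction xs) (auto simp: a_ac)

lemma list_sum_zero [simp]: "list_sum G (\<lambda>x. \<zero>) xs = \<zero>"
  by (induction xs) auto

lemma list_sum_swap:
  assumes "\<And>x y. x \<in> set xs \<Longrightarrow> y \<in> set ys \<Longrightarrow> b x y \<in> carrier G"
  shows "list_sum G (\<lambda>x. list_sum G (b x) ys) xs = list_sum G (\<lambda>y. list_sum G (\<lambda>x. b x y) xs) ys"
  using assms by (induction xs) (auto simp: list_sum_add)

lemma list_sum_delta:
  assumes "distinct xs" "b j \<in> carrier G"
  shows "list_sum G (\<lambda>i. if i = j then b i else \<zero>) xs = (if j \<in> set xs then b j else \<zero>)"
  using assms by (induction xs) auto

text \<open>Additivity is required on the carrier only and in unbundled form, so that
  \<open>g\<close> can be multiplication by an element, a module action, evaluation of functionals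
  at a point, or the projection \<open>E\<close>.\<close>

lemma hom_list_sum:
  assumes B: "abelian_group B"
    and g: "\<And>x y. x \<in> carrier G \<Longrightarrow> y \<in> carrier G \<Longrightarrow> g (x \<oplus> y) = g x \<oplus>\<^bsub>B\<^esub> g y"
    and g_closed: "\<And>x. x \<in> carrier G \<Longrightarrow> g x \<in> carrier B"
    and b: "\<And>x. x \<in> set xs \<Longrightarrow> b x \<in> carrier G"
  shows "g (list_sum G b xs) = list_sum B (\<lambda>x. g (b x)) xs"
proof -
  interpret B: abelian_group B by fact
  \<comment> \<open>Preservation of zero comes from additivity, since only zero equals its own
    double in a group.\<close>
  have "g \<zero> \<oplus>\<^bsub>B\<^esub> g \<zero> = g \<zero>" using g[of \<zero> \<zero>] by simp
  then have "g \<zero> = \<zero>\<^bsub>B\<^esub>"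
    using g_closed[of \<zero>] B.add.l_cancel_one[of "g \<zero>" "g \<zero>"] by auto
  then show ?thesis using b by (induction xs) (auto simp: g)
qed

end

context ring
begin

lemma list_sum_ldistr:
  assumes "a \<in> carrier R" "\<And>x. x \<in> set xs \<Longrightarrow> b x \<in> carrier R"
  shows "list_sum R b xs \<otimes> a = list_sum R (\<lambda>x. b x \<otimes> a) xs"
  by (rule hom_list_sum) (use assms in \<open>auto simp: l_distr abelian_group_axioms\<close>)

lemma list_sum_rdistr:
  assumes "a \<in> carrier R" "\<And>x. x \<in> set xs \<Longrightarrow> b x \<in> carrier R"
  shows "a \<otimes> list_sum R b xs = list_sum R (\<lambda>x. a \<otimes> b x) xs"
  by (rule hom_list_sum) (use assms in \<open>auto simp: r_distr abelian_group_axioms\<close>)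

end

section \<open>The splitting of the dual\<close>

abbreviation pair_sum :: "('c, 'k) ring_scheme \<Rightarrow> ('a \<Rightarrow> 'b \<Rightarrow> 'c) \<Rightarrow> ('a \<times> 'b) list \<Rightarrow> 'c" where
  "pair_sum G b ps \<equiv> list_sum G (\<lambda>p. b (fst p) (snd p)) ps"

text \<open>These maps correspond to additive maps from the tensor product of \<open>M\<close> with
  itself over \<open>N\<close> into \<open>M\<close>. An equation between tensors is stated below by
  testing both sides against every such \<open>b\<close>, which keeps cosets out of the main
  computation.\<close>

definition ring_balanced ::
  "('n, 'k) ring_scheme \<Rightarrow> ('m, 'l) ring_scheme \<Rightarrow> ('n \<Rightarrow> 'm) \<Rightarrow> ('m \<Rightarrow> 'm \<Rightarrow> 'm) \<Rightarrow> bool" where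
  "ring_balanced N M f b \<longleftrightarrow>
     (\<forall>x\<in>carrier M. \<forall>y\<in>carrier M. b x y \<in> carrier M) \<and>
     (\<forall>x\<in>carrier M. \<forall>x'\<in>carrier M. \<forall>y\<in>carrier M. b (x \<oplus>\<^bsub>M\<^esub> x') y = b x y \<oplus>\<^bsub>M\<^esub> b x' y) \<and>
     (\<forall>x\<in>carrier M. \<forall>y\<in>carrier M. \<forall>y'\<in>carrier M. b x (y \<oplus>\<^bsub>M\<^esub> y') = b x y \<oplus>\<^bsub>M\<^esub> b x y') \<and>
     (\<forall>x\<in>carrier M. \<forall>r\<in>carrier N. \<forall>y\<in>carrier M. b (x \<otimes>\<^bsub>M\<^esub> f r) y = b x (f r \<otimes>\<^bsub>M\<^esub> y))"

text \<open>The list \<open>t i\<close> stands for a tensor. \<open>t_comm\<close> says that this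
  tensor commutes with \<open>N\<close>, and \<open>t_dual\<close> is the reconstruction of the pure
  tensor of \<open>x\<close> and \<open>y\<close> from its coordinates
  \<open>\<beta> i x \<otimes> y\<close>, both tested against balanced maps.\<close>

locale left_quasibase = ring_hom_ring N M f for N :: "('n, 'a) ring_scheme" and M :: "('m, 'b) ring_scheme" (structure) and f +
  fixes k :: nat and t and \<beta>
  assumes t_carrier: "i < k \<Longrightarrow> set (t i) \<subseteq> carrier M \<times> carrier M"
    and \<beta>_closed: "\<lbrakk>i < k; x \<in> carrier M\<rbrakk> \<Longrightarrow> \<beta> i x \<in> carrier M"
    and \<beta>_add: "\<lbrakk>i < k; x \<in> carrier M; y \<in> carrier M\<rbrakk> \<Longrightarrow> \<beta> i (x \<oplus> y) = \<beta> i x \<oplus> \<beta> i y"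
    and \<beta>_left: "\<lbrakk>i < k; r \<in> carrier N; x \<in> carrier M\<rbrakk> \<Longrightarrow> \<beta> i (f r \<otimes> x) = f r \<otimes> \<beta> i x"
    and \<beta>_right: "\<lbrakk>i < k; r \<in> carrier N; x \<in> carrier M\<rbrakk> \<Longrightarrow> \<beta> i (x \<otimes> f r) = \<beta> i x \<otimes> f r"
    and t_comm: "\<lbrakk>i < k; r \<in> carrier N; ring_balanced N M f b\<rbrakk> \<Longrightarrow>
      pair_sum M (\<lambda>x y. b (f r \<otimes> x) y) (t i) = pair_sum M (\<lambda>x y. b x (y \<otimes> f r)) (t i)"
    and t_dual: "\<lbrakk>x \<in> carrier M; y \<in> carrier M; ring_balanced N M f b\<rbrakk> \<Longrightarrow>
      list_sum M (\<lambda>i. pair_sum M (\<lambda>a c. b a (c \<otimes> (\<beta> i x \<otimes> y))) (t i)) [0..<k] = b x y"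
begin

lemma t_fst: "\<lbrakk>p \<in> set (t i); i < k\<rbrakk> \<Longrightarrow> fst p \<in> carrier M"
  and t_snd: "\<lbrakk>p \<in> set (t i); i < k\<rbrakk> \<Longrightarrow> snd p \<in> carrier M"
  using t_carrier by fastforce+

end

text \<open>\<open>e\<close> lists the pure tensors of a separability idempotent:
  \<open>e_comm\<close> says that it commutes with all of \<open>M\<close>, again tested against
  balanced maps.\<close>

locale separability_element = ring_hom_ring N M f for N :: "('n, 'a) ring_scheme" and M :: "('m, 'b) ring_scheme" (structure) and f +
  fixes e
  assumes e_carrier: "set e \<subseteq> carrier M \<times> carrier M"
    and e_comm: "\<lbrakk>x \<in> carrier M; ring_balanced N M f b\<rbrakk> \<Longrightarrow>
      pair_sum M (\<lambda>c d. b (x \<otimes> c) d) e = pair_sum M (\<lambda>c d. b c (d \<otimes> x)) e"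
    and e_one: "pair_sum M (\<lambda>c d. c \<otimes> d) e = \<one>"
begin

lemma e_fst: "p \<in> set e \<Longrightarrow> fst p \<in> carrier M" and e_snd: "p \<in> set e \<Longrightarrow> snd p \<in> carrier M"
  using e_carrier by fastforce+

end

text \<open>An abstract isomorphism of \<open>M\<close> with the sum of \<open>N\<close> and
  \<open>V\<close> may move the unit of \<open>M\<close> off the summand \<open>N\<close>. Hence
  \<open>E\<close> is normalised at an element \<open>z\<close> commuting with \<open>N\<close>,
  which need not be the unit.\<close>

locale split_projection = ring_hom_ring N M f for N :: "('n, 'a) ring_scheme" and M :: "('m, 'b) ring_scheme" (structure) and f +
  fixes E z
  assumes E_closed: "x \<in> carrier M \<Longrightarrow> E x \<in> carrier N"
    and E_add: "\<lbrakk>x \<in> carrier M; y \<in> carrier M\<rbrakk> \<Longrightarrow> E (x \<oplus> y) = E x \<oplus>\<^bsub>N\<^esub> E y"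
    and E_left: "\<lbrakk>r \<in> carrier N; x \<in> carrier M\<rbrakk> \<Longrightarrow> E (f r \<otimes> x) = r \<otimes>\<^bsub>N\<^esub> E x"
    and E_right: "\<lbrakk>r \<in> carrier N; x \<in> carrier M\<rbrakk> \<Longrightarrow> E (x \<otimes> f r) = E x \<otimes>\<^bsub>N\<^esub> r"
    and z_closed: "z \<in> carrier M"
    and z_comm: "r \<in> carrier N \<Longrightarrow> f r \<otimes> z = z \<otimes> f r"
    and E_z: "E z = \<one>\<^bsub>N\<^esub>"

locale left_QF_data = left_quasibase N M f k t \<beta> + separability_element N M f e +
    split_projection N M f E z
  for N :: "('n, 'a) ring_scheme" and M :: "('m, 'b) ring_scheme" (structure) and f k t \<beta> e E z
begin

lemma ring_balancedI:
  assumes "\<And>x y. \<lbrakk>x \<in> carrier M; y \<in> carrier M\<rbrakk> \<Longrightarrow> b x y \<in> carrier M"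
    and "\<And>x x' y. \<lbrakk>x \<in> carrier M; x' \<in> carrier M; y \<in> carrier M\<rbrakk> \<Longrightarrow> b (x \<oplus> x') y = b x y \<oplus> b x' y"
    and "\<And>x y y'. \<lbrakk>x \<in> carrier M; y \<in> carrier M; y' \<in> carrier M\<rbrakk> \<Longrightarrow> b x (y \<oplus> y') = b x y \<oplus> b x y'"
    and "\<And>x r y. \<lbrakk>x \<in> carrier M; r \<in> carrier N; y \<in> carrier M\<rbrakk> \<Longrightarrow> b (x \<otimes> f r) y = b x (f r \<otimes> y)"
  shows "ring_balanced N M f b"
  using assms 
      by (simp add: ring_balanced_def)

section \<open>The dual of \<open>M\<close> and the maps between it and \<open>M\<close>\<close>

abbreviation Mdual :: "('n, 'm, 'm \<Rightarrow> 'n) bimod" where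
  "Mdual \<equiv> right_dual N (ring_bimod M id f)"

lemma carrier_Mdual_iff:
  "\<phi> \<in> carrier Mdual \<longleftrightarrow>
     (\<forall>x\<in>carrier M. \<phi> x \<in> carrier N) \<and>
     (\<forall>x\<in>carrier M. \<forall>y\<in>carrier M. \<phi> (x \<oplus> y) = \<phi> x \<oplus>\<^bsub>N\<^esub> \<phi> y) \<and>
     (\<forall>r\<in>carrier N. \<forall>x\<in>carrier M. \<phi> (x \<otimes> f r) = \<phi> x \<otimes>\<^bsub>N\<^esub> r) \<and>
     \<phi> \<in> extensional (carrier M)"
  by (auto simp: right_dual_def right_hom_def hom_def ring_bimod_def)

lemma Mdual_closed [simp]: "\<lbrakk>\<phi> \<in> carrier Mdual; x \<in> carrier M\<rbrakk> \<Longrightarrow> \<phi> x \<in> carrier N"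
  and Mdual_add: "\<lbrakk>\<phi> \<in> carrier Mdual; x \<in> carrier M; y \<in> carrier M\<rbrakk> \<Longrightarrow> \<phi> (x \<oplus> y) = \<phi> x \<oplus>\<^bsub>N\<^esub> \<phi> y"
  and Mdual_right: "\<lbrakk>\<phi> \<in> carrier Mdual; r \<in> carrier N; x \<in> carrier M\<rbrakk> \<Longrightarrow> \<phi> (x \<otimes> f r) = \<phi> x \<otimes>\<^bsub>N\<^esub> r"
  by (auto simp: carrier_Mdual_iff)

lemma lact_Mdual [simp]: "lact Mdual r \<phi> = (\<lambda>x\<in>carrier M. r \<otimes>\<^bsub>N\<^esub> \<phi> x)"
  and ract_Mdual [simp]: "ract Mdual \<phi> m = (\<lambda>x\<in>carrier M. \<phi> (m \<otimes> x))"
  and add_Mdual [simp]: "\<phi> \<oplus>\<^bsub>Mdual\<^esub> \<psi> = (\<lambda>x\<in>carrier M. \<phi> x \<oplus>\<^bsub>N\<^esub> \<psi> x)"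
  by (simp_all add: right_dual_def ring_bimod_def)

text \<open>\<open>Y i \<phi>\<close> is the \<open>i\<close>-th coordinate of \<open>z \<phi>(c -) \<in> End(M\<^sub>N)\<close> in the \<open>M\<close>-\<open>N\<close>-bimodule
  decomposition \<open>\<alpha> = \<Sum>\<^sub>i \<alpha>(t\<^sub>i) \<beta>\<^sub>i\<close> coming from depth two.\<close>

definition Y :: "nat \<Rightarrow> ('m \<Rightarrow> 'n) \<Rightarrow> 'm \<Rightarrow> 'm" where
  "Y i \<phi> c = pair_sum M (\<lambda>a b. z \<otimes> f (\<phi> (c \<otimes> a)) \<otimes> b) (t i)"

text \<open>The depth two coordinates of a tensor are the maps sending the pure tensor of
  \<open>x\<close> and \<open>y\<close> to \<open>\<beta> l x \<otimes> y\<close>. Here the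
  \<open>l\<close>-th one is applied to the sum over \<open>e\<close> of the pure tensors of
  \<open>Y i \<phi> c\<close> and \<open>d\<close>.\<close>

definition U :: "nat \<Rightarrow> nat \<Rightarrow> ('m \<Rightarrow> 'n) \<Rightarrow> 'm" where
  "U i l \<phi> = pair_sum M (\<lambda>c d. \<beta> l (Y i \<phi> c) \<otimes> d) e"

text \<open>Goes back in reverse order: \<open>m\<close> gives the tensor \<open>t l\<close>
  multiplied by \<open>m\<close> on the right, a pure tensor of \<open>a\<close> and
  \<open>y\<close> gives the endomorphism
  \<open>x \<mapsto> a \<otimes> \<beta> i (y \<otimes> x)\<close>, and composition with
  \<open>E\<close> lands in the dual.\<close>

definition V :: "nat \<Rightarrow> nat \<Rightarrow> 'm \<Rightarrow> 'm \<Rightarrow> 'n" where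
  "V i l m = (\<lambda>x\<in>carrier M. E (pair_sum M (\<lambda>a c. a \<otimes> \<beta> i (c \<otimes> m \<otimes> x)) (t l)))"

lemmas data_closed [simp] = e_fst e_snd E_closed z_closed

section \<open>Bimodule linearity of \<open>U i l\<close> and \<open>V i l\<close> for fixed
  indices\<close>

context
  fixes i l assumes i: "i < k" and l: "l < k"
begin

lemmas il_closed [simp] = t_fst[OF _ i] t_snd[OF _ i] t_fst[OF _ l] t_snd[OF _ l] \<beta>_closed[OF i] \<beta>_closed[OF l]
lemmas il_add = \<beta>_add[OF i] \<beta>_add[OF l]
lemmas il_left = \<beta>_left[OF i] \<beta>_left[OF l]
lemmas il_right = \<beta>_right[OF i] \<beta>_right[OF l]

lemma Y_closed [simp]: "\<lbrakk>\<phi> \<in> carrier Mdual; c \<in> carrier M\<rbrakk> \<Longrightarrow> Y i \<phi> c \<in> carrier M"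
  unfolding Y_def using i by simp

lemma U_closed [simp]: "\<phi> \<in> carrier Mdual \<Longrightarrow> U i l \<phi> \<in> carrier M"
  unfolding U_def using i l by simp

lemma Y_add:
  assumes "\<phi> \<in> carrier Mdual" "c \<in> carrier M" "c' \<in> carrier M"
  shows "Y i \<phi> (c \<oplus> c') = Y i \<phi> c \<oplus> Y i \<phi> c'"
  unfolding Y_def using i assms
  by (subst list_sum_add[symmetric])
    (simp_all add: l_distr r_distr Mdual_add)

text \<open>The scalar \<open>f r\<close> enters next to the first factor of \<open>t i\<close>.
  Since that tensor commutes with \<open>N\<close>, it can be moved behind the second
  factor.\<close>

lemma Y_right:
  assumes \<phi>: "\<phi> \<in> carrier Mdual" and c: "c \<in> carrier M" and r: "r \<in> carrier N"
  shows "Y i \<phi> (c \<otimes> f r) = Y i \<phi> c \<otimes> f r"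
proof -
  let ?b = "\<lambda>a b. z \<otimes> f (\<phi> (c \<otimes> a)) \<otimes> b"
  have b: "ring_balanced N M f ?b"
    using \<phi> c by (intro ring_balancedI)
      (simp_all add: r_distr l_distr Mdual_add Mdual_right m_assoc[symmetric])
  have "Y i \<phi> (c \<otimes> f r) = pair_sum M (\<lambda>a b. ?b (f r \<otimes> a) b) (t i)"
    unfolding Y_def using i c r 
      by (simp add: m_assoc)
  also have "\<dots> = pair_sum M (\<lambda>a b. ?b a (b \<otimes> f r)) (t i)"
    using t_comm[OF i r b] .
  also have "\<dots> = Y i \<phi> c \<otimes> f r"
    unfolding Y_def using i c r \<phi>
    by (subst list_sum_ldistr) (simp_all add: m_assoc)
  finally show ?thesis .
qed

text \<open>This is what allows \<open>e_comm\<close> to be applied to the sum defining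
  \<open>U\<close>.\<close>

lemma U_summand_balanced:
  assumes \<phi>: "\<phi> \<in> carrier Mdual"
  shows "ring_balanced N M f (\<lambda>c d. \<beta> l (Y i \<phi> c) \<otimes> d)"
  using \<phi> i l by (intro ring_balancedI)
    (simp_all add: r_distr l_distr Y_add Y_right il_add il_right m_assoc)

lemma Y_dual_add:
  assumes "\<phi> \<in> carrier Mdual" "\<psi> \<in> carrier Mdual" "c \<in> carrier M"
  shows "Y i (\<phi> \<oplus>\<^bsub>Mdual\<^esub> \<psi>) c = Y i \<phi> c \<oplus> Y i \<psi> c"
  unfolding Y_def using i assms
  by (subst list_sum_add[symmetric]) (simp_all add: l_distr r_distr)

text \<open>The scalar comes out on the left because \<open>z\<close> commutes with the image of
  \<open>N\<close>.\<close>

lemma Y_dual_left: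
  assumes "\<phi> \<in> carrier Mdual" "r \<in> carrier N" "c \<in> carrier M"
  shows "Y i (lact Mdual r \<phi>) c = f r \<otimes> Y i \<phi> c"
  unfolding Y_def using i assms
  by (subst list_sum_rdistr) (simp_all add: m_assoc[symmetric] z_comm)

lemma Y_dual_right:
  assumes "\<phi> \<in> carrier Mdual" "m \<in> carrier M" "c \<in> carrier M"
  shows "Y i (ract Mdual \<phi> m) c = Y i \<phi> (m \<otimes> c)"
  unfolding Y_def using i assms
  by (simp_all add: m_assoc)

lemma U_bimod_hom: "U i l \<in> bimod_hom N M Mdual (ring_bimod M f id)"
proof -
  have "U i l (\<phi> \<oplus>\<^bsub>Mdual\<^esub> \<psi>) = U i l \<phi> \<oplus> U i l \<psi>"
    if "\<phi> \<in> carrier Mdual" "\<psi> \<in> carrier Mdual" for \<phi> \<psi>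
    unfolding U_def using that i l
    by (subst list_sum_add[symmetric])
      (simp_all add: Y_dual_add il_add l_distr del: add_Mdual)
  moreover have "U i l (lact Mdual r \<phi>) = f r \<otimes> U i l \<phi>"
    if "\<phi> \<in> carrier Mdual" "r \<in> carrier N" for r \<phi>
    unfolding U_def using that i l
    by (subst list_sum_rdistr)
      (simp_all add: Y_dual_left il_left m_assoc del: lact_Mdual)
  \<comment> \<open>Right linearity over all of \<open>M\<close> comes from separability:
    \<open>m\<close> acts in front of the first factor of \<open>e\<close>, and
    \<open>e_comm\<close> carries it behind the second.\<close>
  moreover have "U i l (ract Mdual \<phi> m) = U i l \<phi> \<otimes> m"
    if \<phi>: "\<phi> \<in> carrier Mdual" and m: "m \<in> carrier M" for m \<phi>
  proof -
    have "U i l (ract Mdual \<phi> m) = pair_sum M (\<lambda>c d. \<beta> l (Y i \<phi> (m \<otimes> c)) \<otimes> d) e"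
      unfolding U_def using that i l
      by (simp add: Y_dual_right del: ract_Mdual)
    also have "\<dots> = pair_sum M (\<lambda>c d. \<beta> l (Y i \<phi> c) \<otimes> (d \<otimes> m)) e"
      using e_comm[OF m U_summand_balanced[OF \<phi>]] .
    also have "\<dots> = U i l \<phi> \<otimes> m"
      unfolding U_def using that i l
      by (subst list_sum_ldistr) (simp_all add: m_assoc)
    finally show ?thesis .
  qed
  ultimately show ?thesis
    by (auto simp: bimod_hom_def left_hom_def right_hom_def hom_def ring_bimod_def[of M f id]
      simp del: lact_Mdual ract_Mdual add_Mdual)
qed

lemma V_in_dual:
  assumes m: "m \<in> carrier M"
  shows "V i l m \<in> carrier Mdual"
proof -
  let ?s = "\<lambda>x. pair_sum M (\<lambda>a c. a \<otimes> \<beta> i (c \<otimes> m \<otimes> x)) (t l)"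
  have s_closed: "?s x \<in> carrier M" if "x \<in> carrier M" for x
    using that m i l by simp
  have "?s (x \<oplus> y) = ?s x \<oplus> ?s y" if "x \<in> carrier M" "y \<in> carrier M" for x y
    using that m i l by (subst list_sum_add[symmetric])
      (simp_all add: r_distr il_add)
  moreover have "?s (x \<otimes> f r) = ?s x \<otimes> f r" if "x \<in> carrier M" "r \<in> carrier N" for x r
    using that m i l by (subst list_sum_ldistr)
      (simp_all add: m_assoc[symmetric] il_right)
  ultimately show ?thesis
    unfolding carrier_Mdual_iff V_def
    using s_closed by (auto simp: E_add E_right)
qed

lemma V_bimod_hom: "V i l \<in> bimod_hom N M (ring_bimod M f id) Mdual"
proof -
  have "V i l (m \<oplus> m') = V i l m \<oplus>\<^bsub>Mdual\<^esub> V i l m'" if "m \<in> carrier M" "m' \<in> carrier M" for m m'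
  proof -
    have "E (pair_sum M (\<lambda>a c. a \<otimes> \<beta> i (c \<otimes> (m \<oplus> m') \<otimes> x)) (t l)) =
      E (pair_sum M (\<lambda>a c. a \<otimes> \<beta> i (c \<otimes> m \<otimes> x)) (t l) \<oplus>
        pair_sum M (\<lambda>a c. a \<otimes> \<beta> i (c \<otimes> m' \<otimes> x)) (t l))" if "x \<in> carrier M" for x
      using that \<open>m \<in> carrier M\<close> \<open>m' \<in> carrier M\<close> i l
      by (subst list_sum_add[symmetric])
        (simp_all add: r_distr l_distr il_add)
    then show ?thesis
      unfolding V_def using that i l by (auto simp: E_add intro!: restrict_ext)
  qed
  \<comment> \<open>Here \<open>f r\<close> stands to the right of the second factor of
    \<open>t l\<close>. Commutation with \<open>N\<close> brings it in front of the first factor,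
    and left linearity of \<open>E\<close> takes it out.\<close>
  moreover have "V i l (f r \<otimes> m) = lact Mdual r (V i l m)"
    if r: "r \<in> carrier N" and m: "m \<in> carrier M" for r m
  proof -
    have "E (pair_sum M (\<lambda>a c. a \<otimes> \<beta> i (c \<otimes> (f r \<otimes> m) \<otimes> x)) (t l)) =
        r \<otimes>\<^bsub>N\<^esub> E (pair_sum M (\<lambda>a c. a \<otimes> \<beta> i (c \<otimes> m \<otimes> x)) (t l))"
      if x: "x \<in> carrier M" for x
    proof -
      let ?b = "\<lambda>a c. a \<otimes> \<beta> i (c \<otimes> m \<otimes> x)"
      have b: "ring_balanced N M f ?b"
        using m x i l by (intro ring_balancedI)
          (simp_all add: r_distr l_distr il_add il_left m_assoc)
      have "pair_sum M (\<lambda>a c. a \<otimes> \<beta> i (c \<otimes> (f r \<otimes> m) \<otimes> x)) (t l) =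
          pair_sum M (\<lambda>a c. ?b a (c \<otimes> f r)) (t l)"
        using m x r l 
      by (simp add: m_assoc)
      also have "\<dots> = pair_sum M (\<lambda>a c. ?b (f r \<otimes> a) c) (t l)"
        using t_comm[OF l r b] by simp
      also have "\<dots> = f r \<otimes> pair_sum M ?b (t l)"
        using m x r i l by (subst list_sum_rdistr) (simp_all add: m_assoc)
      finally show ?thesis using m x r i l by (auto simp: E_left)
    qed
    then show ?thesis unfolding V_def by (auto intro!: restrict_ext)
  qed
  moreover have "V i l (m \<otimes> m') = ract Mdual (V i l m) m'"
    if "m \<in> carrier M" "m' \<in> carrier M" for m m'
    unfolding V_def using that i l
    by (auto intro!: restrict_ext list_sum_cong arg_cong[of _ _ E] simp: m_assoc)
  ultimately show ?thesis
    using V_in_dual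
    by (auto simp: bimod_hom_def left_hom_def right_hom_def hom_def ring_bimod_def[of M f id]
      simp del: lact_Mdual ract_Mdual add_Mdual)
qed

end

text \<open>The constructions are undone one at a time: the sum over \<open>l\<close> removes the
  second use of depth two, the sum over \<open>i\<close> the first, \<open>e_one\<close> removes the
  separability element and \<open>E_z\<close> the element \<open>z\<close>.\<close>

lemma V_U_identity:
  assumes \<phi>: "\<phi> \<in> carrier Mdual" and x: "x \<in> carrier M"
  shows "list_sum N (\<lambda>i. list_sum N (\<lambda>l. V i l (U i l \<phi>) x) [0..<k]) [0..<k] = \<phi> x"
proof -
  \<comment> \<open>Only the sum over \<open>l\<close> is treated here. It recombines the
    coordinates \<open>U i l \<phi>\<close> into the tensor with terms \<open>Y i \<phi> c\<close>
    and \<open>d\<close>, through the balanced map \<open>a \<otimes> \<beta> i c\<close>.\<close>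
  have sum_l: "list_sum M (\<lambda>l. pair_sum M (\<lambda>a c. a \<otimes> \<beta> i (c \<otimes> U i l \<phi> \<otimes> x)) (t l)) [0..<k] =
      pair_sum M (\<lambda>c d. Y i \<phi> c \<otimes> \<beta> i (d \<otimes> x)) e" (is "?L = ?R") if i: "i < k" for i
  proof -
    have b: "ring_balanced N M f (\<lambda>a c. a \<otimes> \<beta> i c)"
      using i by (intro ring_balancedI)
        (simp_all add: \<beta>_closed \<beta>_add \<beta>_left r_distr l_distr m_assoc)
    \<comment> \<open>The map \<open>u \<mapsto> a \<otimes> \<beta> i (c \<otimes> u \<otimes>
      x)\<close> is additive, so the sum over \<open>e\<close> hidden in \<open>U\<close> can be
      taken outside. The two exchanges of sums that follow put the sums over \<open>l\<close> and
      \<open>t l\<close> innermost.\<close>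
    have "a \<otimes> \<beta> i (c \<otimes> U i l \<phi> \<otimes> x) =
        pair_sum M (\<lambda>c' d. a \<otimes> \<beta> i (c \<otimes> (\<beta> l (Y i \<phi> c') \<otimes> (d \<otimes> x)))) e"
      if "a \<in> carrier M" "c \<in> carrier M" "l < k" for a c l
      unfolding U_def using that i x \<phi>
      by (subst hom_list_sum[where g = "\<lambda>u. a \<otimes> \<beta> i (c \<otimes> u \<otimes> x)" and B = M])
        (simp_all add: abelian_group_axioms \<beta>_add r_distr l_distr m_assoc \<beta>_closed)
    then have "?L = list_sum M (\<lambda>l. list_sum M (\<lambda>p. pair_sum M
        (\<lambda>c' d. fst p \<otimes> \<beta> i (snd p \<otimes> (\<beta> l (Y i \<phi> c') \<otimes> (d \<otimes> x)))) e) (t l)) [0..<k]"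
      by (simp add: t_fst t_snd)
    also have "\<dots> = list_sum M (\<lambda>l. list_sum M (\<lambda>q. pair_sum M
        (\<lambda>a c. a \<otimes> \<beta> i (c \<otimes> (\<beta> l (Y i \<phi> (fst q)) \<otimes> (snd q \<otimes> x)))) (t l)) e) [0..<k]"
      using i x \<phi> by (intro list_sum_cong list_sum_swap) (simp_all add: t_fst t_snd \<beta>_closed)
    also have "\<dots> = list_sum M (\<lambda>q. list_sum M (\<lambda>l. pair_sum M
        (\<lambda>a c. a \<otimes> \<beta> i (c \<otimes> (\<beta> l (Y i \<phi> (fst q)) \<otimes> (snd q \<otimes> x)))) (t l)) [0..<k]) e"
      using i x \<phi> by (intro list_sum_swap) (simp_all add: t_fst t_snd \<beta>_closed)
    \<comment> \<open>For each entry \<open>q\<close> of \<open>e\<close>, \<open>t_dual\<close> is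
      used at the pure tensor of \<open>Y i \<phi> (fst q)\<close> and
      \<open>snd q \<otimes> x\<close>.\<close>
    also have "\<dots> = ?R"
      using i x \<phi> by (intro list_sum_cong t_dual b) simp_all
    finally show ?thesis .
  qed
  \<comment> \<open>The endomorphism
    \<open>w \<mapsto> z \<otimes> f (\<phi> (c \<otimes> w))\<close> is recovered from its
    coordinates \<open>Y i \<phi> c\<close>. This is \<open>t_dual\<close> with second argument the
    unit.\<close>
  have sum_i: "list_sum M (\<lambda>i. Y i \<phi> c \<otimes> \<beta> i w) [0..<k] = z \<otimes> f (\<phi> (c \<otimes> w))"
    if "c \<in> carrier M" "w \<in> carrier M" for c w
  proof -
    let ?b = "\<lambda>a b. z \<otimes> f (\<phi> (c \<otimes> a)) \<otimes> b"
    have b: "ring_balanced N M f ?b"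
      using \<phi> that by (intro ring_balancedI)
        (simp_all add: r_distr l_distr Mdual_add Mdual_right m_assoc[symmetric])
    have "list_sum M (\<lambda>i. Y i \<phi> c \<otimes> \<beta> i w) [0..<k] =
        list_sum M (\<lambda>i. pair_sum M (\<lambda>a d. ?b a (d \<otimes> (\<beta> i w \<otimes> \<one>))) (t i)) [0..<k]"
      unfolding Y_def using that \<phi>
      by (simp add: list_sum_ldistr t_fst t_snd \<beta>_closed m_assoc)
    also have "\<dots> = ?b w \<one>"
      using t_dual[OF that(2) _ b, of \<one>] by simp
    finally show ?thesis using that \<phi> by simp
  qed
  have "list_sum N (\<lambda>i. list_sum N (\<lambda>l. V i l (U i l \<phi>) x) [0..<k]) [0..<k] =
      list_sum N (\<lambda>i. list_sum N (\<lambda>l. E (pair_sum M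
        (\<lambda>a c. a \<otimes> \<beta> i (c \<otimes> U i l \<phi> \<otimes> x)) (t l))) [0..<k]) [0..<k]"
    by (simp add: V_def x)
  also have "\<dots> = list_sum N (\<lambda>i. E (list_sum M (\<lambda>l. pair_sum M
        (\<lambda>a c. a \<otimes> \<beta> i (c \<otimes> U i l \<phi> \<otimes> x)) (t l)) [0..<k])) [0..<k]"
    using x \<phi> by (intro list_sum_cong hom_list_sum[symmetric])
      (simp_all add: R.abelian_group_axioms E_add t_fst t_snd \<beta>_closed)
  also have "\<dots> = list_sum N (\<lambda>i. E (pair_sum M (\<lambda>c d. Y i \<phi> c \<otimes> \<beta> i (d \<otimes> x)) e)) [0..<k]"
    by (simp add: sum_l)
  also have "\<dots> = E (list_sum M (\<lambda>i. pair_sum M (\<lambda>c d. Y i \<phi> c \<otimes> \<beta> i (d \<otimes> x)) e) [0..<k])"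
    using x \<phi> by (intro hom_list_sum[symmetric])
      (simp_all add: R.abelian_group_axioms E_add \<beta>_closed)
  also have "list_sum M (\<lambda>i. pair_sum M (\<lambda>c d. Y i \<phi> c \<otimes> \<beta> i (d \<otimes> x)) e) [0..<k] =
      list_sum M (\<lambda>q. list_sum M (\<lambda>i. Y i \<phi> (fst q) \<otimes> \<beta> i (snd q \<otimes> x)) [0..<k]) e"
    using x \<phi> by (intro list_sum_swap) (simp_all add: \<beta>_closed)
  also have "\<dots> = pair_sum M (\<lambda>c d. z \<otimes> f (\<phi> (c \<otimes> d \<otimes> x))) e"
    using x by (simp add: sum_i m_assoc)
  \<comment> \<open>The factors \<open>c\<close> and \<open>d\<close> of \<open>e\<close> now stand
    side by side inside \<open>\<phi>\<close>, so additivity gathers them into the product of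
    \<open>e\<close>, which is the unit.\<close>
  also have "\<dots> = z \<otimes> f (\<phi> (pair_sum M (\<lambda>c d. c \<otimes> d) e \<otimes> x))"
    using x \<phi> by (subst hom_list_sum[where g = "\<lambda>u. z \<otimes> f (\<phi> (u \<otimes> x))" and B = M])
      (simp_all add: abelian_group_axioms r_distr l_distr Mdual_add)
  also have "\<dots> = z \<otimes> f (\<phi> x)"
    using x by (simp add: e_one)
  \<comment> \<open>Right linearity of \<open>E\<close> gives \<open>E z\<close> times
    \<open>\<phi> x\<close>, and \<open>E z\<close> is the unit of \<open>N\<close>.\<close>
  finally show ?thesis
    using \<phi> x by (simp add: E_right E_z)
qed

end

section \<open>Summands and retracts of bimodules\<close>

lemma bimod_hom_iff:
  "h \<in> bimod_hom R S A B \<longleftrightarrow>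
     (\<forall>x\<in>carrier A. h x \<in> carrier B) \<and>
     (\<forall>x\<in>carrier A. \<forall>y\<in>carrier A. h (x \<oplus>\<^bsub>A\<^esub> y) = h x \<oplus>\<^bsub>B\<^esub> h y) \<and>
     (\<forall>r\<in>carrier R. \<forall>x\<in>carrier A. h (lact A r x) = lact B r (h x)) \<and>
     (\<forall>s\<in>carrier S. \<forall>x\<in>carrier A. h (ract A x s) = ract B (h x) s)"
  by (auto simp: bimod_hom_def left_hom_def right_hom_def hom_def)

lemma bimod_homI:
  assumes "\<And>x. x \<in> carrier A \<Longrightarrow> h x \<in> carrier B"
    and "\<And>x y. \<lbrakk>x \<in> carrier A; y \<in> carrier A\<rbrakk> \<Longrightarrow> h (x \<oplus>\<^bsub>A\<^esub> y) = h x \<oplus>\<^bsub>B\<^esub> h y"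
    and "\<And>r x. \<lbrakk>r \<in> carrier R; x \<in> carrier A\<rbrakk> \<Longrightarrow> h (lact A r x) = lact B r (h x)"
    and "\<And>s x. \<lbrakk>s \<in> carrier S; x \<in> carrier A\<rbrakk> \<Longrightarrow> h (ract A x s) = ract B (h x) s"
  shows "h \<in> bimod_hom R S A B"
  using assms by (simp add: bimod_hom_iff)

lemma
  assumes "h \<in> bimod_hom R S A B"
  shows bimod_hom_closed: "x \<in> carrier A \<Longrightarrow> h x \<in> carrier B"
    and bimod_hom_add: "\<lbrakk>x \<in> carrier A; y \<in> carrier A\<rbrakk> \<Longrightarrow> h (x \<oplus>\<^bsub>A\<^esub> y) = h x \<oplus>\<^bsub>B\<^esub> h y"
    and bimod_hom_lact: "\<lbrakk>r \<in> carrier R; x \<in> carrier A\<rbrakk> \<Longrightarrow> h (lact A r x) = lact B r (h x)"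
    and bimod_hom_ract: "\<lbrakk>s \<in> carrier S; x \<in> carrier A\<rbrakk> \<Longrightarrow> h (ract A x s) = ract B (h x) s"
  using assms by (auto simp: bimod_hom_iff)

lemma bimod_hom_comp:
  assumes "g \<in> bimod_hom R S A B" "h \<in> bimod_hom R S B C"
  shows "(\<lambda>x. h (g x)) \<in> bimod_hom R S A C"
  using assms unfolding bimod_hom_iff by simp

lemma bimod_hom_list_sum:
  assumes "h \<in> bimod_hom R S A B" "abelian_group A" "abelian_group B"
    and "\<And>x. x \<in> set xs \<Longrightarrow> b x \<in> carrier A"
  shows "h (list_sum A b xs) = list_sum B (\<lambda>x. h (b x)) xs"
  using assms by (intro abelian_group.hom_list_sum) (auto simp: bimod_hom_iff)

context bimodule
begin

sublocale abelian_group A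
  by (rule left_abelian_group)

lemma lact_zero_right: "r \<in> carrier R \<Longrightarrow> lact A r \<zero>\<^bsub>A\<^esub> = \<zero>\<^bsub>A\<^esub>"
  using lact_add_right[of r "\<zero>\<^bsub>A\<^esub>" "\<zero>\<^bsub>A\<^esub>"] lact_closed[of r "\<zero>\<^bsub>A\<^esub>"]
    add.l_cancel_one[of "lact A r \<zero>\<^bsub>A\<^esub>" "lact A r \<zero>\<^bsub>A\<^esub>"] by simp

lemma ract_zero_left: "s \<in> carrier S \<Longrightarrow> ract A \<zero>\<^bsub>A\<^esub> s = \<zero>\<^bsub>A\<^esub>"
  using ract_add_left[of s "\<zero>\<^bsub>A\<^esub>" "\<zero>\<^bsub>A\<^esub>"] ract_closed[of s "\<zero>\<^bsub>A\<^esub>"]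
    add.l_cancel_one[of "ract A \<zero>\<^bsub>A\<^esub> s" "ract A \<zero>\<^bsub>A\<^esub> s"] by simp

end

text \<open>The composite of \<open>v\<close> followed by \<open>u\<close> is an idempotent of
  \<open>B\<close>. It splits \<open>B\<close> into the image of \<open>u\<close> and the kernel of
  \<open>v\<close>.\<close>

lemma bimod_summand_if_retract:
  assumes A: "bimodule R S A" and B: "bimodule R S B"
    and u: "u \<in> bimod_hom R S A B" and v: "v \<in> bimod_hom R S B A"
    and vu: "\<And>x. x \<in> carrier A \<Longrightarrow> v (u x) = x"
  shows "bimod_summand R S A B"
proof -
  interpret A: bimodule R S A by fact
  interpret B: bimodule R S B by fact
  interpret u: group_hom "add_monoid A" "add_monoid B" u
    using u by unfold_locales (auto simp: bimod_hom_iff hom_def)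
  interpret v: group_hom "add_monoid B" "add_monoid A" v
    using v by unfold_locales (auto simp: bimod_hom_iff hom_def)
  let ?P = "u ` carrier A" and ?Q = "{x \<in> carrier B. v x = \<zero>\<^bsub>A\<^esub>}"
  have "additive_subgroup ?P B"
    using u.img_is_subgroup by (simp add: additive_subgroup_def)
  moreover have "additive_subgroup ?Q B"
    using v.subgroup_kernel by (simp add: additive_subgroup_def kernel_def)
  moreover have "lact B r x \<in> ?P" if "r \<in> carrier R" and x: "x \<in> ?P" for r x
  proof -
    obtain y where "y \<in> carrier A" "x = u y" using x by auto
    then show ?thesis using that bimod_hom_lact[OF u, symmetric] A.lact_closed by simp
  qed
  moreover have "ract B x s \<in> ?P" if "s \<in> carrier S" and x: "x \<in> ?P" for s x
  proof -
    obtain y where "y \<in> carrier A" "x = u y" using x by auto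
    then show ?thesis using that bimod_hom_ract[OF u, symmetric] A.ract_closed by simp
  qed
  moreover have "lact B r x \<in> ?Q" if "r \<in> carrier R" "x \<in> ?Q" for r x
    using that bimod_hom_lact[OF v] B.lact_closed by (simp add: A.lact_zero_right)
  moreover have "ract B x s \<in> ?Q" if "s \<in> carrier S" "x \<in> ?Q" for s x
    using that bimod_hom_ract[OF v] B.ract_closed by (simp add: A.ract_zero_left)
  moreover have "internal_sum B ?P ?Q"
    unfolding internal_sum_def
  proof
    show "?P \<inter> ?Q = {\<zero>\<^bsub>B\<^esub>}"
      using u.hom_one v.hom_one vu by (auto intro!: image_eqI[of _ _ "\<zero>\<^bsub>A\<^esub>"])
    have "y \<in> ?P <+>\<^bsub>B\<^esub> ?Q" if y: "y \<in> carrier B" for y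
    proof -
      have uvy: "u (v y) \<in> carrier B" and vy: "v y \<in> carrier A"
        using y u v by (auto simp: bimod_hom_iff)
      have "v (y \<ominus>\<^bsub>B\<^esub> u (v y)) = v y \<ominus>\<^bsub>A\<^esub> v (u (v y))"
        using y uvy v.hom_inv[of "u (v y)"] bimod_hom_add[OF v]
        by (simp add: a_minus_def a_inv_def)
      then have "y \<ominus>\<^bsub>B\<^esub> u (v y) \<in> ?Q"
        using y uvy vy vu by (simp add: A.r_neg a_minus_def)
      moreover have "y = u (v y) \<oplus>\<^bsub>B\<^esub> (y \<ominus>\<^bsub>B\<^esub> u (v y))"
        using y uvy by (simp add: a_minus_def B.a_ac B.r_neg)
      ultimately show ?thesis
        using vy by (auto simp: set_add_def set_mult_def)
    qed
    then show "?P <+>\<^bsub>B\<^esub> ?Q = carrier B"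
      using bimod_hom_closed[OF u] by (auto simp: set_add_def set_mult_def)
  qed
  moreover have "bij_betw u (carrier A) ?P"
    by (metis bij_betw_def inj_onI vu)
  ultimately show ?thesis
    using u unfolding bimod_summand_def sub_bimodule_def left_submodule_def right_submodule_def
    by (intro exI[of _ ?P] exI[of _ ?Q]) blast
qed

text \<open>\<open>v\<close> is the projection onto \<open>P\<close> along \<open>Q\<close> followed
  by the inverse of \<open>u\<close>. The conditions on \<open>A\<close> are a group structure and
  closure under the actions, the facts available for the tensor products to which this is
  applied.\<close>

lemma retract_if_bimod_summand:
  fixes A :: "('r, 's, 'a) bimod" and B :: "('r, 's, 'b) bimod"
  assumes A_group: "abelian_group A"
    and A_lact: "\<And>r x. \<lbrakk>r \<in> carrier R; x \<in> carrier A\<rbrakk> \<Longrightarrow> lact A r x \<in> carrier A"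
    and A_ract: "\<And>s x. \<lbrakk>s \<in> carrier S; x \<in> carrier A\<rbrakk> \<Longrightarrow> ract A x s \<in> carrier A"
    and B: "bimodule R S B" and AB: "bimod_summand R S A B"
  obtains u v where "u \<in> bimod_hom R S A B" "v \<in> bimod_hom R S B A"
    "\<And>x. x \<in> carrier A \<Longrightarrow> v (u x) = x"
proof -
  interpret A: abelian_group A by fact
  interpret B: bimodule R S B by fact
  obtain P Q u where P: "sub_bimodule R S P B" and Q: "sub_bimodule R S Q B"
    and PQ: "internal_sum B P Q" and u: "u \<in> bimod_hom R S A B" and bij: "bij_betw u (carrier A) P"
    using AB unfolding bimod_summand_def by blast
  interpret P: additive_subgroup P B
    using P by (simp add: sub_bimodule_def left_submodule_def)
  interpret Q: additive_subgroup Q B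
    using Q by (simp add: sub_bimodule_def left_submodule_def)
  have P_act: "\<And>r x. r \<in> carrier R \<Longrightarrow> x \<in> P \<Longrightarrow> lact B r x \<in> P"
      "\<And>s x. s \<in> carrier S \<Longrightarrow> x \<in> P \<Longrightarrow> ract B x s \<in> P"
    and Q_act: "\<And>r x. r \<in> carrier R \<Longrightarrow> x \<in> Q \<Longrightarrow> lact B r x \<in> Q"
      "\<And>s x. s \<in> carrier S \<Longrightarrow> x \<in> Q \<Longrightarrow> ract B x s \<in> Q"
    using P Q by (auto simp: sub_bimodule_def left_submodule_def right_submodule_def)
  have P_sub: "x \<in> P \<Longrightarrow> x \<in> carrier B" and Q_sub: "x \<in> Q \<Longrightarrow> x \<in> carrier B" for x
    using P.a_subset Q.a_subset by auto
  \<comment> \<open>The difference of two decompositions lies in both \<open>P\<close> and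
    \<open>Q\<close>, hence is zero; injectivity of \<open>u\<close> does the rest.\<close>
  have unique: "x = x'"
    if "x \<in> carrier A" "x' \<in> carrier A" "q \<in> Q" "q' \<in> Q" "u x \<oplus>\<^bsub>B\<^esub> q = u x' \<oplus>\<^bsub>B\<^esub> q'" for x x' q q'
  proof -
    have uP: "u x \<in> P" "u x' \<in> P" using that bij by (auto simp: bij_betw_def)
    note [simp] = uP[THEN P_sub] that(3,4)[THEN Q_sub]
    have "u x \<ominus>\<^bsub>B\<^esub> u x' = q' \<ominus>\<^bsub>B\<^esub> q"
    proof -
      have "u x = u x' \<oplus>\<^bsub>B\<^esub> q' \<ominus>\<^bsub>B\<^esub> q"
        using that(5)[symmetric] by (simp add: a_minus_def B.a_assoc B.r_neg)
      also have "\<dots> = (q' \<ominus>\<^bsub>B\<^esub> q) \<oplus>\<^bsub>B\<^esub> u x'"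
        by (simp add: a_minus_def B.a_ac)
      finally show ?thesis by (simp add: a_minus_def B.a_assoc B.r_neg)
    qed
    moreover have "u x \<ominus>\<^bsub>B\<^esub> u x' \<in> P"
      using uP by (simp add: a_minus_def P.a_inv_closed P.a_closed)
    moreover have "q' \<ominus>\<^bsub>B\<^esub> q \<in> Q"
      using that(3,4) by (simp add: a_minus_def Q.a_inv_closed Q.a_closed)
    ultimately have "u x \<ominus>\<^bsub>B\<^esub> u x' = \<zero>\<^bsub>B\<^esub>"
      using PQ by (auto simp: internal_sum_def)
    moreover have "u x = (u x \<ominus>\<^bsub>B\<^esub> u x') \<oplus>\<^bsub>B\<^esub> u x'"
      by (simp add: a_minus_def B.a_assoc B.l_neg)
    ultimately have "u x = u x'" by simp
    then show ?thesis using bij that by (auto simp: bij_betw_def inj_on_def)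
  qed
  have "\<exists>x\<in>carrier A. \<exists>q\<in>Q. u x \<oplus>\<^bsub>B\<^esub> q = y" if "y \<in> carrier B" for y
  proof -
    have "y \<in> P <+>\<^bsub>B\<^esub> Q" using PQ that by (simp add: internal_sum_def)
    then show ?thesis using bij by (fastforce simp: set_add_def set_mult_def bij_betw_def)
  qed
  then obtain v w where vw: "\<And>y. y \<in> carrier B \<Longrightarrow> v y \<in> carrier A"
    "\<And>y. y \<in> carrier B \<Longrightarrow> w y \<in> Q" "\<And>y. y \<in> carrier B \<Longrightarrow> u (v y) \<oplus>\<^bsub>B\<^esub> w y = y"
    by metis
  \<comment> \<open>Any decomposition of \<open>y\<close> identifies \<open>v y\<close>. Each
    linearity law for \<open>v\<close> therefore reduces to exhibiting a decomposition of the
    element in question.\<close>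
  have v_eq: "v y = x" if "x \<in> carrier A" "q \<in> Q" "y = u x \<oplus>\<^bsub>B\<^esub> q" for x y q
  proof -
    have "y \<in> carrier B" using that bimod_hom_closed[OF u] Q_sub by auto
    then show ?thesis using unique[of "v y" x "w y" q] vw[of y] that by auto
  qed
  have uv_closed: "u (v y) \<in> carrier B" "w y \<in> carrier B" if "y \<in> carrier B" for y
    using that vw bimod_hom_closed[OF u] Q_sub by auto
  have "v \<in> bimod_hom R S B A"
  proof (rule bimod_homI)
    show "v (x \<oplus>\<^bsub>B\<^esub> y) = v x \<oplus>\<^bsub>A\<^esub> v y" if "x \<in> carrier B" "y \<in> carrier B" for x y
    proof (rule v_eq)
      have "x \<oplus>\<^bsub>B\<^esub> y = (u (v x) \<oplus>\<^bsub>B\<^esub> w x) \<oplus>\<^bsub>B\<^esub> (u (v y) \<oplus>\<^bsub>B\<^esub> w y)"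
        using vw(3) that by simp
      also have "\<dots> = u (v x \<oplus>\<^bsub>A\<^esub> v y) \<oplus>\<^bsub>B\<^esub> (w x \<oplus>\<^bsub>B\<^esub> w y)"
        using that uv_closed vw(1) bimod_hom_add[OF u] by (simp add: B.a_ac)
      finally show "x \<oplus>\<^bsub>B\<^esub> y = u (v x \<oplus>\<^bsub>A\<^esub> v y) \<oplus>\<^bsub>B\<^esub> (w x \<oplus>\<^bsub>B\<^esub> w y)" .
    qed (use that vw in \<open>auto intro: Q.a_closed\<close>)
    show "v (lact B r y) = lact A r (v y)" if "r \<in> carrier R" "y \<in> carrier B" for r y
    proof (rule v_eq)
      have "lact B r y = lact B r (u (v y) \<oplus>\<^bsub>B\<^esub> w y)"
        using vw(3) that by simp
      then show "lact B r y = u (lact A r (v y)) \<oplus>\<^bsub>B\<^esub> lact B r (w y)"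
        using that uv_closed vw(1) bimod_hom_lact[OF u] by (simp add: B.lact_add_right)
    qed (use that vw A_lact Q_act in auto)
    show "v (ract B y s) = ract A (v y) s" if "s \<in> carrier S" "y \<in> carrier B" for s y
    proof (rule v_eq)
      have "ract B y s = ract B (u (v y) \<oplus>\<^bsub>B\<^esub> w y) s"
        using vw(3) that by simp
      then show "ract B y s = u (ract A (v y) s) \<oplus>\<^bsub>B\<^esub> ract B (w y) s"
        using that uv_closed vw(1) bimod_hom_ract[OF u] by (simp add: B.ract_add_left)
    qed (use that vw A_ract Q_act in auto)
  qed (use vw in simp)
  moreover have "v (u x) = x" if "x \<in> carrier A" for x
    using v_eq[OF that Q.zero_closed] bimod_hom_closed[OF u that] by simp
  ultimately show thesis using that u by blast
qed

section \<open>Bimodule structures on finite sums of copies, on the ring and on the dual\<close>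

lemma bimoduleI:
  assumes "ring R" "ring S" "abelian_group A"
    and "\<And>r x. \<lbrakk>r \<in> carrier R; x \<in> carrier A\<rbrakk> \<Longrightarrow> lact A r x \<in> carrier A"
    and "\<And>r x y. \<lbrakk>r \<in> carrier R; x \<in> carrier A; y \<in> carrier A\<rbrakk>
      \<Longrightarrow> lact A r (x \<oplus>\<^bsub>A\<^esub> y) = lact A r x \<oplus>\<^bsub>A\<^esub> lact A r y"
    and "\<And>r r' x. \<lbrakk>r \<in> carrier R; r' \<in> carrier R; x \<in> carrier A\<rbrakk>
      \<Longrightarrow> lact A (r \<oplus>\<^bsub>R\<^esub> r') x = lact A r x \<oplus>\<^bsub>A\<^esub> lact A r' x"
    and "\<And>r r' x. \<lbrakk>r \<in> carrier R; r' \<in> carrier R; x \<in> carrier A\<rbrakk>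
      \<Longrightarrow> lact A (r \<otimes>\<^bsub>R\<^esub> r') x = lact A r (lact A r' x)"
    and "\<And>x. x \<in> carrier A \<Longrightarrow> lact A \<one>\<^bsub>R\<^esub> x = x"
    and "\<And>s x. \<lbrakk>s \<in> carrier S; x \<in> carrier A\<rbrakk> \<Longrightarrow> ract A x s \<in> carrier A"
    and "\<And>s x y. \<lbrakk>s \<in> carrier S; x \<in> carrier A; y \<in> carrier A\<rbrakk>
      \<Longrightarrow> ract A (x \<oplus>\<^bsub>A\<^esub> y) s = ract A x s \<oplus>\<^bsub>A\<^esub> ract A y s"
    and "\<And>s s' x. \<lbrakk>s \<in> carrier S; s' \<in> carrier S; x \<in> carrier A\<rbrakk>
      \<Longrightarrow> ract A x (s \<oplus>\<^bsub>S\<^esub> s') = ract A x s \<oplus>\<^bsub>A\<^esub> ract A x s'"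
    and "\<And>s s' x. \<lbrakk>s \<in> carrier S; s' \<in> carrier S; x \<in> carrier A\<rbrakk>
      \<Longrightarrow> ract A x (s \<otimes>\<^bsub>S\<^esub> s') = ract A (ract A x s) s'"
    and "\<And>x. x \<in> carrier A \<Longrightarrow> ract A x \<one>\<^bsub>S\<^esub> = x"
    and "\<And>r s x. \<lbrakk>r \<in> carrier R; s \<in> carrier S; x \<in> carrier A\<rbrakk>
      \<Longrightarrow> ract A (lact A r x) s = lact A r (ract A x s)"
  shows "bimodule R S A"
  by (intro bimodule.intro left_module.intro right_module.intro bimodule_axioms.intro) (fact assms)+

lemma carrier_copies_finite:
  "finite I \<Longrightarrow> carrier (copies I A) = (I \<rightarrow>\<^sub>E carrier A)"
  by (auto simp: copies_def)

lemma copies_simps [simp]: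
  "\<zero>\<^bsub>copies I A\<^esub> = (\<lambda>i\<in>I. \<zero>\<^bsub>A\<^esub>)"
  "x \<oplus>\<^bsub>copies I A\<^esub> y = (\<lambda>i\<in>I. x i \<oplus>\<^bsub>A\<^esub> y i)"
  "lact (copies I A) r x = (\<lambda>i\<in>I. lact A r (x i))"
  "ract (copies I A) x s = (\<lambda>i\<in>I. ract A (x i) s)"
  by (simp_all add: copies_def)

lemma bimodule_copies:
  assumes A: "bimodule R S A" and I: "finite I"
  shows "bimodule R S (copies I A)"
proof -
  interpret A: bimodule R S A by fact
  have group: "abelian_group (copies I A)"
  proof (rule abelian_groupI)
    show "\<exists>y\<in>carrier (copies I A). y \<oplus>\<^bsub>copies I A\<^esub> x = \<zero>\<^bsub>copies I A\<^esub>"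
      if "x \<in> carrier (copies I A)" for x
      using that I
      by (intro bexI[of _ "\<lambda>i\<in>I. \<ominus>\<^bsub>A\<^esub> x i"])
        (auto simp: carrier_copies_finite PiE_iff A.l_neg intro!: restrict_ext)
  qed (use I in \<open>auto simp: carrier_copies_finite PiE_iff A.a_ac extensional_def fun_eq_iff\<close>)
  show ?thesis
    by (rule bimoduleI)
      (use I A.left_ring A.right_ring in \<open>auto simp: carrier_copies_finite group PiE_iff A.lact_closed
        A.ract_closed A.lact_add_left A.lact_add_right A.ract_add_left A.ract_add_right A.lact_assoc
        A.ract_assoc A.lact_one A.ract_one A.lact_ract extensional_def fun_eq_iff\<close>)
qed

lemma bimodule_ring_bimod:
  assumes f: "ring_hom_ring R M f" and g: "ring_hom_ring S M g"
  shows "bimodule R S (ring_bimod M f g)"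
proof -
  interpret f: ring_hom_ring R M f by fact
  interpret g: ring_hom_ring S M g by fact
  have "abelian_group (ring_bimod M f g)"
  proof (rule abelian_groupI)
    show "\<exists>y\<in>carrier (ring_bimod M f g). y \<oplus>\<^bsub>ring_bimod M f g\<^esub> x = \<zero>\<^bsub>ring_bimod M f g\<^esub>"
      if "x \<in> carrier (ring_bimod M f g)" for x
      using that by (intro bexI[of _ "\<ominus>\<^bsub>M\<^esub> x"]) (simp_all add: ring_bimod_def f.S.l_neg)
  qed (simp_all add: ring_bimod_def f.S.a_ac)
  then show ?thesis
    by (intro bimoduleI)
      (auto simp: ring_bimod_def f.S.l_distr f.S.r_distr f.S.m_assoc f.R.ring_axioms g.R.ring_axioms)
qed

lemma bimodule_right_dual:
  assumes A: "bimodule R S A"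
  shows "bimodule S R (right_dual S A)"
proof -
  interpret A: bimodule R S A by fact
  interpret R: ring R by (rule A.left_ring)
  interpret S: ring S by (rule A.right_ring)
  have carrier_iff: "\<phi> \<in> carrier (right_dual S A) \<longleftrightarrow>
     (\<forall>x\<in>carrier A. \<phi> x \<in> carrier S) \<and>
     (\<forall>x\<in>carrier A. \<forall>y\<in>carrier A. \<phi> (x \<oplus>\<^bsub>A\<^esub> y) = \<phi> x \<oplus>\<^bsub>S\<^esub> \<phi> y) \<and>
     (\<forall>s\<in>carrier S. \<forall>x\<in>carrier A. \<phi> (ract A x s) = \<phi> x \<otimes>\<^bsub>S\<^esub> s) \<and>
     \<phi> \<in> extensional (carrier A)" for \<phi>
    by (auto simp: right_dual_def right_hom_def hom_def ring_bimod_def)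
  have closed: "\<phi> x \<in> carrier S" and add: "\<phi> (x \<oplus>\<^bsub>A\<^esub> y) = \<phi> x \<oplus>\<^bsub>S\<^esub> \<phi> y"
    and ract: "s \<in> carrier S \<Longrightarrow> \<phi> (ract A x s) = \<phi> x \<otimes>\<^bsub>S\<^esub> s"
    if "\<phi> \<in> carrier (right_dual S A)" "x \<in> carrier A" "y \<in> carrier A" for \<phi> x y s
    using that unfolding carrier_iff by blast+
  have ext: "\<phi> \<in> extensional (carrier A)" if "\<phi> \<in> carrier (right_dual S A)" for \<phi>
    using that unfolding carrier_iff by blast
  have [simp]: "\<zero>\<^bsub>right_dual S A\<^esub> = (\<lambda>x\<in>carrier A. \<zero>\<^bsub>S\<^esub>)"
    "\<phi> \<oplus>\<^bsub>right_dual S A\<^esub> \<psi> = (\<lambda>x\<in>carrier A. \<phi> x \<oplus>\<^bsub>S\<^esub> \<psi> x)"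
    "lact (right_dual S A) s \<phi> = (\<lambda>x\<in>carrier A. s \<otimes>\<^bsub>S\<^esub> \<phi> x)"
    "ract (right_dual S A) \<phi> r = (\<lambda>x\<in>carrier A. \<phi> (lact A r x))" for \<phi> \<psi> s r
    by (simp_all add: right_dual_def)
  have ext_eq: "\<phi> = \<psi>" if "\<phi> \<in> extensional (carrier A)" "\<psi> \<in> extensional (carrier A)"
    "\<And>x. x \<in> carrier A \<Longrightarrow> \<phi> x = \<psi> x" for \<phi> \<psi>
    using that by (rule extensionalityI)
  have group: "abelian_group (right_dual S A)"
  proof (rule abelian_groupI)
    show "\<exists>\<psi>\<in>carrier (right_dual S A). \<psi> \<oplus>\<^bsub>right_dual S A\<^esub> \<phi> = \<zero>\<^bsub>right_dual S A\<^esub>"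
      if "\<phi> \<in> carrier (right_dual S A)" for \<phi>
    proof
      show "(\<lambda>x\<in>carrier A. \<ominus>\<^bsub>S\<^esub> \<phi> x) \<in> carrier (right_dual S A)"
        \<comment> \<open>Instantiating the criterion at restricted functions unfolds membership for
          the new functional only, leaving the assumption on \<open>\<phi>\<close> in the form that
          \<open>closed\<close>, \<open>add\<close> and \<open>ract\<close> expect.\<close>
        using that by (simp add: carrier_iff[of "restrict _ _"] closed add ract A.ract_closed S.minus_add S.l_minus)
      show "(\<lambda>x\<in>carrier A. \<ominus>\<^bsub>S\<^esub> \<phi> x) \<oplus>\<^bsub>right_dual S A\<^esub> \<phi> = \<zero>\<^bsub>right_dual S A\<^esub>"
        using that by (intro ext_eq) (simp_all add: closed S.l_neg)
    qed
    show "\<phi> \<oplus>\<^bsub>right_dual S A\<^esub> \<psi> \<in> carrier (right_dual S A)"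
      if "\<phi> \<in> carrier (right_dual S A)" "\<psi> \<in> carrier (right_dual S A)" for \<phi> \<psi>
      using that by (simp add: carrier_iff[of "restrict _ _"] closed add ract A.ract_closed S.l_distr S.a_ac)
    show "\<zero>\<^bsub>right_dual S A\<^esub> \<in> carrier (right_dual S A)"
      by (simp add: carrier_iff A.ract_closed)
  qed (auto intro!: ext_eq simp: closed ext S.a_ac)
  have l: "lact (right_dual S A) s \<phi> \<in> carrier (right_dual S A)"
    if "s \<in> carrier S" "\<phi> \<in> carrier (right_dual S A)" for s \<phi>
    using that by (simp add: carrier_iff[of "restrict _ _"] closed add ract A.ract_closed S.r_distr S.m_assoc)
  have r: "ract (right_dual S A) \<phi> r \<in> carrier (right_dual S A)"
    if "r \<in> carrier R" "\<phi> \<in> carrier (right_dual S A)" for r \<phi>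
    using that by (simp add: carrier_iff[of "restrict _ _"] closed add ract A.ract_closed A.lact_closed
      A.lact_add_right A.lact_ract[symmetric])
  show ?thesis
    by (intro bimoduleI) (auto intro!: ext_eq l[simplified] r[simplified] simp: group S.ring_axioms R.ring_axioms closed ext add ract
      A.lact_closed A.ract_closed A.lact_add_left A.lact_assoc A.lact_one S.l_distr S.r_distr S.m_assoc
      )
qed

section \<open>Coordinates on finite sums of copies\<close>

definition copies_inj :: "'i set \<Rightarrow> ('r, 's, 'a) bimod \<Rightarrow> 'i \<Rightarrow> 'a \<Rightarrow> 'i \<Rightarrow> 'a" where
  "copies_inj I A i x = (\<lambda>j\<in>I. if j = i then x else \<zero>\<^bsub>A\<^esub>)"

lemma copies_inj_bimod_hom:
  assumes "bimodule R S A" "finite I"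
  shows "copies_inj I A i \<in> bimod_hom R S A (copies I A)"
proof -
  interpret bimodule R S A by fact
  show ?thesis
    by (intro bimod_homI) (auto simp: copies_inj_def carrier_copies_finite assms
      lact_zero_right ract_zero_left intro!: restrict_ext)
qed

lemma copies_proj_bimod_hom:
  assumes "finite I" "i \<in> I"
  shows "(\<lambda>x. x i) \<in> bimod_hom R S (copies I A) A"
  using assms by (intro bimod_homI) (auto simp: carrier_copies_finite)

text \<open>Compared coordinate by coordinate: projection to \<open>j\<close> is additive and turns
  the sum into one with a single nonzero term.\<close>

lemma copies_decomposition:
  assumes A: "bimodule R S A" and x: "x \<in> carrier (copies {..<n} A)"
  shows "list_sum (copies {..<n} A) (\<lambda>i. copies_inj {..<n} A i (x i)) [0..<n] = x"
    (is "?y = x")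
proof -
  interpret A: bimodule R S A by fact
  interpret C: bimodule R S "copies {..<n} A" by (rule bimodule_copies[OF A]) simp
  have x': "x i \<in> carrier A" if "i < n" for i
    using x that by (auto simp: carrier_copies_finite)
  have inj: "copies_inj {..<n} A i (x i) \<in> carrier (copies {..<n} A)" if "i < n" for i
    by (rule bimod_hom_closed[OF copies_inj_bimod_hom[OF A] x']) (simp_all add: that)
  have y: "?y \<in> carrier (copies {..<n} A)"
    by (rule C.list_sum_closed) (simp add: inj)
  have "?y j = x j" if j: "j < n" for j
  proof -
    have "?y j = list_sum A (\<lambda>i. copies_inj {..<n} A i (x i) j) [0..<n]"
      by (rule bimod_hom_list_sum[OF copies_proj_bimod_hom])
        (use j inj in \<open>auto simp: C.abelian_group_axioms A.abelian_group_axioms\<close>)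
    also have "\<dots> = list_sum A (\<lambda>i. if i = j then x i else \<zero>\<^bsub>A\<^esub>) [0..<n]"
      using j by (intro list_sum_cong) (auto simp: copies_inj_def)
    also have "\<dots> = x j" using j x' by (subst A.list_sum_delta) auto
    finally show ?thesis .
  qed
  then show ?thesis
    using x y by (intro extensionalityI[of _ "{..<n}"]) (auto simp: carrier_copies_finite PiE_iff)
qed

text \<open>The maps \<open>fst p\<close> are the coordinates of a map into the copies and the maps
  \<open>snd p\<close> are summed to a map back; the last hypothesis says that this is a
  retraction.\<close>

lemma bimod_summand_copiesI:
  assumes A: "bimodule R S A" and B: "bimodule R S B"
    and hom: "\<And>p. p \<in> set ps \<Longrightarrow> fst p \<in> bimod_hom R S A B"
      "\<And>p. p \<in> set ps \<Longrightarrow> snd p \<in> bimod_hom R S B A"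
    and sum: "\<And>x. x \<in> carrier A \<Longrightarrow> list_sum A (\<lambda>p. snd p (fst p x)) ps = x"
  shows "bimod_summand R S A (copies {..<length ps} B)"
proof (rule bimod_summand_if_retract[OF A bimodule_copies[OF B]])
  interpret A: bimodule R S A by fact
  interpret B: bimodule R S B by fact
  let ?n = "length ps"
  let ?u = "\<lambda>x. \<lambda>i\<in>{..<?n}. fst (ps ! i) x"
  let ?v = "\<lambda>y. list_sum A (\<lambda>i. snd (ps ! i) (y i)) [0..<?n]"
  have U: "fst (ps ! i) \<in> bimod_hom R S A B" and V: "snd (ps ! i) \<in> bimod_hom R S B A"
    if "i < ?n" for i
    using that hom nth_mem by blast+
  note [simp] = U[THEN bimod_hom_closed] V[THEN bimod_hom_closed] U[THEN bimod_hom_add]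
    V[THEN bimod_hom_add] U[THEN bimod_hom_lact] V[THEN bimod_hom_lact] U[THEN bimod_hom_ract]
    V[THEN bimod_hom_ract]
  show "finite {..<?n}" by simp
  show "?u \<in> bimod_hom R S A (copies {..<?n} B)"
    by (intro bimod_homI) (auto simp: carrier_copies_finite intro!: restrict_ext)
  show "?v \<in> bimod_hom R S (copies {..<?n} B) A"
  proof (rule bimod_homI)
    fix x assume x: "x \<in> carrier (copies {..<?n} B)"
    then have [simp]: "x i \<in> carrier B" if "i < ?n" for i
      using that by (auto simp: carrier_copies_finite)
    show "?v x \<in> carrier A" by (rule A.list_sum_closed) simp
    show "?v (x \<oplus>\<^bsub>copies {..<?n} B\<^esub> y) = ?v x \<oplus>\<^bsub>A\<^esub> ?v y"
      if y: "y \<in> carrier (copies {..<?n} B)" for y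
    proof -
      have [simp]: "y i \<in> carrier B" if "i < ?n" for i
        using y that by (auto simp: carrier_copies_finite)
      show ?thesis by (subst A.list_sum_add[symmetric]) simp_all
    qed
    show "?v (lact (copies {..<?n} B) r x) = lact A r (?v x)" if r: "r \<in> carrier R" for r
      by (subst A.hom_list_sum[OF A.abelian_group_axioms, where g = "lact A r"])
        (simp_all add: r A.lact_closed A.lact_add_right)
    show "?v (ract (copies {..<?n} B) x s) = ract A (?v x) s" if s: "s \<in> carrier S" for s
      by (subst A.hom_list_sum[OF A.abelian_group_axioms, where g = "\<lambda>x. ract A x s"])
        (simp_all add: s A.ract_closed A.ract_add_left)
  qed
  show "?v (?u x) = x" if "x \<in> carrier A" for x
  proof -
    have "?v (?u x) = list_sum A (\<lambda>p. snd p (fst p x)) (map ((!) ps) [0..<?n])"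
      by simp
    then show ?thesis using sum[OF that] by (simp only: map_nth)
  qed
qed

text \<open>The converse: a retraction is composed with the coordinate projections and injections,
  and the decomposition of an element into its coordinates gives the sum formula.\<close>

lemma bimod_summand_copiesE:
  assumes A: "abelian_group A"
    and A_lact: "\<And>r x. \<lbrakk>r \<in> carrier R; x \<in> carrier A\<rbrakk> \<Longrightarrow> lact A r x \<in> carrier A"
    and A_ract: "\<And>s x. \<lbrakk>s \<in> carrier S; x \<in> carrier A\<rbrakk> \<Longrightarrow> ract A x s \<in> carrier A"
    and B: "bimodule R S B"
    and AB: "bimod_summand R S A (copies {..<n} B)"
  obtains u v where "\<forall>i<n. u i \<in> bimod_hom R S A B" "\<forall>i<n. v i \<in> bimod_hom R S B A"
    "\<forall>x\<in>carrier A. list_sum A (\<lambda>i. v i (u i x)) [0..<n] = x"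
proof -
  interpret B: bimodule R S B by fact
  interpret C: bimodule R S "copies {..<n} B" by (rule bimodule_copies[OF B]) simp
  obtain u v where u: "u \<in> bimod_hom R S A (copies {..<n} B)"
    and v: "v \<in> bimod_hom R S (copies {..<n} B) A" and vu: "\<And>x. x \<in> carrier A \<Longrightarrow> v (u x) = x"
    using retract_if_bimod_summand[OF A A_lact A_ract
      C.bimodule_axioms AB] by blast
  have inj: "copies_inj {..<n} B i \<in> bimod_hom R S B (copies {..<n} B)" for i
    by (rule copies_inj_bimod_hom[OF B]) simp
  show thesis
  proof
    show "\<forall>i<n. (\<lambda>x. u x i) \<in> bimod_hom R S A B"
      using bimod_hom_comp[OF u copies_proj_bimod_hom] by simp
    show "\<forall>i<n. (\<lambda>y. v (copies_inj {..<n} B i y)) \<in> bimod_hom R S B A"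
      using bimod_hom_comp[OF inj v] by simp
    have "list_sum A (\<lambda>i. v (copies_inj {..<n} B i (u x i))) [0..<n] = x" if "x \<in> carrier A" for x
    proof -
      have ux: "u x \<in> carrier (copies {..<n} B)" using bimod_hom_closed[OF u that] .
      have "list_sum A (\<lambda>i. v (copies_inj {..<n} B i (u x i))) [0..<n] =
          v (list_sum (copies {..<n} B) (\<lambda>i. copies_inj {..<n} B i (u x i)) [0..<n])"
        by (rule bimod_hom_list_sum[OF v, symmetric])
          (use ux in \<open>auto simp: C.abelian_group_axioms A carrier_copies_finite
            simp del: copies_simps intro!: bimod_hom_closed[OF inj, unfolded carrier_copies_finite[OF finite_lessThan]]\<close>)
      then show ?thesis using copies_decomposition[OF B ux] vu that by simp
    qed
    then show "\<forall>x\<in>carrier A. list_sum A (\<lambda>i. v (copies_inj {..<n} B i (u x i))) [0..<n] = x"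
      by simp
  qed
qed

section \<open>Tensor products as finite sums of pure tensors\<close>

definition balanced ::
  "('s, 'k) ring_scheme \<Rightarrow> ('r, 's, 'a) bimod \<Rightarrow> ('s, 't, 'b) bimod \<Rightarrow> ('c, 'l) ring_scheme \<Rightarrow>
   ('a \<Rightarrow> 'b \<Rightarrow> 'c) \<Rightarrow> bool" where
  "balanced S A B G b \<longleftrightarrow>
     (\<forall>x\<in>carrier A. \<forall>y\<in>carrier B. b x y \<in> carrier G) \<and>
     (\<forall>x\<in>carrier A. \<forall>x'\<in>carrier A. \<forall>y\<in>carrier B. b (x \<oplus>\<^bsub>A\<^esub> x') y = b x y \<oplus>\<^bsub>G\<^esub> b x' y) \<and>
     (\<forall>x\<in>carrier A. \<forall>y\<in>carrier B. \<forall>y'\<in>carrier B. b x (y \<oplus>\<^bsub>B\<^esub> y') = b x y \<oplus>\<^bsub>G\<^esub> b x y') \<and>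
     (\<forall>x\<in>carrier A. \<forall>s\<in>carrier S. \<forall>y\<in>carrier B. b (ract A x s) y = b x (lact B s y))"

text \<open>The class of a finite sum of pure tensors. Lists carry no integer coefficients;
  multiplicities are repetitions and signs are absorbed into a factor.\<close>

definition tensor_list ::
  "('s, 'k) ring_scheme \<Rightarrow> ('r, 's, 'a) bimod \<Rightarrow> ('s, 't, 'b) bimod \<Rightarrow> ('a \<times> 'b) list \<Rightarrow>
   ('a \<times> 'b \<Rightarrow>\<^sub>0 int) set" where
  "tensor_list S A B ps = tensor_rels S A B #>\<^bsub>tensor_free A B\<^esub> sum_list (map frag_of ps)"

locale tensor_modules = A: bimodule R S A + B: bimodule S T B
  for R :: "('r, 'k1) ring_scheme" and S :: "('s, 'k2) ring_scheme" and T :: "('t, 'k3) ring_scheme"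
    and A :: "('r, 's, 'a) bimod" and B :: "('s, 't, 'b) bimod"
begin

abbreviation "F \<equiv> tensor_free A B"
abbreviation "K \<equiv> tensor_rels S A B"
abbreviation "AB \<equiv> tensor S A B"

text \<open>The generating set inside \<open>tensor_rels\<close>, given inductively to obtain a case
  rule with one case for each kind of relation.\<close>

inductive_set relators :: "('a \<times> 'b \<Rightarrow>\<^sub>0 int) set" where
  add_left: "\<lbrakk>a \<in> carrier A; a' \<in> carrier A; b \<in> carrier B\<rbrakk> \<Longrightarrow>
    frag_of (a \<oplus>\<^bsub>A\<^esub> a', b) - frag_of (a, b) - frag_of (a', b) \<in> relators"
| add_right: "\<lbrakk>a \<in> carrier A; b \<in> carrier B; b' \<in> carrier B\<rbrakk> \<Longrightarrow>
    frag_of (a, b \<oplus>\<^bsub>B\<^esub> b') - frag_of (a, b) - frag_of (a, b') \<in> relators"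
| balanced: "\<lbrakk>a \<in> carrier A; s \<in> carrier S; b \<in> carrier B\<rbrakk> \<Longrightarrow>
    frag_of (ract A a s, b) - frag_of (a, lact B s b) \<in> relators"

lemma K_eq: "K = generate F relators"
  unfolding tensor_rels_def
  by (rule arg_cong[of _ _ "generate F"]) (auto intro: relators.intros elim!: relators.cases)

lemma F_comm_group: "comm_group F"
  by (simp add: tensor_free_def abelian_free_Abelian_group)

sublocale F: comm_group F by (rule F_comm_group)

lemma F_mult [simp]: "x \<otimes>\<^bsub>F\<^esub> y = x + y"
  and F_one [simp]: "\<one>\<^bsub>F\<^esub> = 0"
  by (simp_all add: tensor_free_def)

lemma carrier_F: "c \<in> carrier F \<longleftrightarrow> Poly_Mapping.keys c \<subseteq> carrier A \<times> carrier B"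
  by (simp add: tensor_free_def)

lemma frag_of_in_F [simp]: "frag_of p \<in> carrier F \<longleftrightarrow> p \<in> carrier A \<times> carrier B"
  by (simp add: carrier_F)

lemma F_inv [simp]: "c \<in> carrier F \<Longrightarrow> inv\<^bsub>F\<^esub> c = - c"
  by (simp add: carrier_F tensor_free_def)

lemma F_diff_closed: "\<lbrakk>c \<in> carrier F; d \<in> carrier F\<rbrakk> \<Longrightarrow> c - d \<in> carrier F"
  using F.m_closed[of c "inv\<^bsub>F\<^esub> d"] F.inv_closed[of d] by simp

lemma F_add_closed: "\<lbrakk>c \<in> carrier F; d \<in> carrier F\<rbrakk> \<Longrightarrow> c + d \<in> carrier F"
  using F.m_closed[of c d] by simp

lemma relators_in_F: "relators \<subseteq> carrier F"
  by (auto elim!: relators.cases intro!: F_diff_closed simp: A.ract_closed B.lact_closed)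

sublocale K: subgroup K F
  unfolding K_eq by (rule F.generate_is_subgroup[OF relators_in_F])

sublocale K: normal K F
  by (rule F.subgroup_imp_normal) (rule K.subgroup_axioms)

lemma coset_eq_iff:
  assumes "c \<in> carrier F" "d \<in> carrier F"
  shows "K #>\<^bsub>F\<^esub> c = K #>\<^bsub>F\<^esub> d \<longleftrightarrow> c - d \<in> K"
proof
  assume "K #>\<^bsub>F\<^esub> c = K #>\<^bsub>F\<^esub> d"
  then have "c \<in> K #>\<^bsub>F\<^esub> d"
    using F.rcos_self[OF assms(1) K.subgroup_axioms] by simp
  then show "c - d \<in> K"
    using K.rcos_module[OF F.is_group assms(2,1)] assms by simp
next
  assume "c - d \<in> K"
  then have "c \<in> K #>\<^bsub>F\<^esub> d"
    using K.rcos_module[OF F.is_group assms(2,1)] assms by simp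
  then show "K #>\<^bsub>F\<^esub> c = K #>\<^bsub>F\<^esub> d"
    using F.repr_independence[OF _ assms(2) K.subgroup_axioms] by simp
qed

lemma tensor_simps:
  "carrier AB = rcosets\<^bsub>F\<^esub> K"
  "\<zero>\<^bsub>AB\<^esub> = K"
  "X \<oplus>\<^bsub>AB\<^esub> Y = X <#>\<^bsub>F\<^esub> Y"
  "lact AB r X = (\<Union>c\<in>X. K #>\<^bsub>F\<^esub> frag_extend (\<lambda>(a, b). frag_of (lact A r a, b)) c)"
  "ract AB X t = (\<Union>c\<in>X. K #>\<^bsub>F\<^esub> frag_extend (\<lambda>(a, b). frag_of (a, ract B b t)) c)"
  by (simp_all add: tensor_def Let_def FactGroup_def)

lemma sum_list_frag_closed:
  "set ps \<subseteq> carrier A \<times> carrier B \<Longrightarrow> sum_list (map frag_of ps) \<in> carrier F"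
proof (induction ps)
  case (Cons p ps)
  then show ?case using F.m_closed[of "frag_of p" "sum_list (map frag_of ps)"] by simp
qed (use F.one_closed in simp)

lemma tensor_list_closed: "set ps \<subseteq> carrier A \<times> carrier B \<Longrightarrow> tensor_list S A B ps \<in> carrier AB"
  by (simp add: tensor_simps tensor_list_def F.rcosetsI[OF K.subset] sum_list_frag_closed)

lemma tensor_list_append:
  assumes "set ps \<subseteq> carrier A \<times> carrier B" "set qs \<subseteq> carrier A \<times> carrier B"
  shows "tensor_list S A B (ps @ qs) = tensor_list S A B ps \<oplus>\<^bsub>AB\<^esub> tensor_list S A B qs"
  using assms by (simp add: tensor_simps tensor_list_def sum_list_frag_closed K.rcos_sum)

lemma tensor_list_Nil: "tensor_list S A B [] = \<zero>\<^bsub>AB\<^esub>"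
  using F.coset_join2[OF F.one_closed K.subgroup_axioms] K.one_closed
  by (simp add: tensor_simps tensor_list_def)

lemma relator_in_K: "c \<in> relators \<Longrightarrow> c \<in> K"
  by (simp add: K_eq generate.incl)

lemmas K_add_left = relator_in_K[OF relators.add_left]
  and K_add_right = relator_in_K[OF relators.add_right]
  and K_balanced = relator_in_K[OF relators.balanced]

lemma tensor_rel_add_left:
  assumes "a \<in> carrier A" "a' \<in> carrier A" "b \<in> carrier B"
  shows "tensor_list S A B [(a \<oplus>\<^bsub>A\<^esub> a', b)] = tensor_list S A B [(a, b), (a', b)]"
  unfolding tensor_list_def using assms K_add_left[OF assms]
  by (subst coset_eq_iff) (simp_all add: diff_diff_eq F_add_closed)

lemma tensor_rel_add_right:
  assumes "a \<in> carrier A" "b \<in> carrier B" "b' \<in> carrier B"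
  shows "tensor_list S A B [(a, b \<oplus>\<^bsub>B\<^esub> b')] = tensor_list S A B [(a, b), (a, b')]"
  unfolding tensor_list_def using assms K_add_right[OF assms]
  by (subst coset_eq_iff) (simp_all add: diff_diff_eq F_add_closed)

lemma tensor_rel_balanced:
  assumes "a \<in> carrier A" "s \<in> carrier S" "b \<in> carrier B"
  shows "tensor_list S A B [(ract A a s, b)] = tensor_list S A B [(a, lact B s b)]"
  unfolding tensor_list_def using assms K_balanced[OF assms]
  by (subst coset_eq_iff) (simp_all add: A.ract_closed B.lact_closed)

lemma K_add: "\<lbrakk>c \<in> K; d \<in> K\<rbrakk> \<Longrightarrow> c + d \<in> K"
  using K.m_closed[of c d] by simp

lemma K_minus: "c \<in> K \<Longrightarrow> - c \<in> K"
  using K.m_inv_closed[of c] K.mem_carrier[of c] by simp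

lemma K_diff: "\<lbrakk>c \<in> K; d \<in> K\<rbrakk> \<Longrightarrow> c - d \<in> K"
  using K_add[OF _ K_minus, of c d] by simp

text \<open>The sign of a pure tensor can be moved into its first factor. This is how negative
  coefficients disappear in \<open>tensor_list_surj\<close>.\<close>

lemma frag_of_neg_in_K:
  assumes a: "a \<in> carrier A" and b: "b \<in> carrier B"
  shows "frag_of (\<ominus>\<^bsub>A\<^esub> a, b) + frag_of (a, b) \<in> K"
proof -
  note * = K_add_left[OF _ _ b]
  have "(frag_of (\<zero>\<^bsub>A\<^esub>, b) - frag_of (\<ominus>\<^bsub>A\<^esub> a, b) - frag_of (a, b)) \<in> K"
    using *[of "\<ominus>\<^bsub>A\<^esub> a" a] a by (simp add: A.l_neg)
  \<comment> \<open>The additivity relator for zero plus zero collapses to minus a single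
    generator.\<close>
  moreover have "- frag_of (\<zero>\<^bsub>A\<^esub>, b) \<in> K"
    using *[of "\<zero>\<^bsub>A\<^esub>" "\<zero>\<^bsub>A\<^esub>"] by simp
  ultimately have "- (- frag_of (\<zero>\<^bsub>A\<^esub>, b) + (frag_of (\<zero>\<^bsub>A\<^esub>, b) - frag_of (\<ominus>\<^bsub>A\<^esub> a, b) - frag_of (a, b))) \<in> K"
    by (rule K_minus[OF K_add, rotated])
  then show ?thesis by (simp add: algebra_simps)
qed

text \<open>Induction over the free abelian group. A difference is handled by concatenating the list
  of the minuend with that of the subtrahend after negating its first factors.\<close>

lemma tensor_list_surj:
  assumes "X \<in> carrier AB"
  obtains ps where "set ps \<subseteq> carrier A \<times> carrier B" "X = tensor_list S A B ps"
proof -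
  let ?C = "carrier A \<times> carrier B" and ?s = "\<lambda>ps. sum_list (map frag_of ps)"
  obtain c where c: "c \<in> carrier F" "X = K #>\<^bsub>F\<^esub> c"
    using assms by (auto simp: tensor_simps RCOSETS_def)
  have "\<exists>ps. set ps \<subseteq> ?C \<and> c - ?s ps \<in> K"
    using c(1)[unfolded carrier_F]
  proof (induction c rule: free_Abelian_group_induct[consumes 1, case_names zero diff gen])
    case zero
    show ?case using K.one_closed by (intro exI[of _ "[]"]) simp
  next
    case (diff x y)
    then obtain ps qs where ps: "set ps \<subseteq> ?C" "x - ?s ps \<in> K" and qs: "set qs \<subseteq> ?C" "y - ?s qs \<in> K"
      by blast
    let ?n = "map (\<lambda>(a, b). (\<ominus>\<^bsub>A\<^esub> a, b)) qs"
    have "?s ?n + ?s qs \<in> K"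
      using qs(1)
    proof (induction qs)
      case (Cons q qs)
      obtain a b where q: "q = (a, b)" by (cases q)
      have "(frag_of (\<ominus>\<^bsub>A\<^esub> a, b) + frag_of (a, b)) +
          (?s (map (\<lambda>(a, b). (\<ominus>\<^bsub>A\<^esub> a, b)) qs) + ?s qs) \<in> K"
        using Cons q by (intro K_add[OF frag_of_neg_in_K]) auto
      then show ?case by (simp add: q algebra_simps)
    qed (use K.one_closed in simp)
    then have "(x - ?s ps) - (y - ?s qs) - (?s ?n + ?s qs) \<in> K"
      using ps qs by (intro K_diff[OF K_diff])
    then have "x - y - ?s (ps @ ?n) \<in> K" by (simp add: algebra_simps)
    moreover have "set (ps @ ?n) \<subseteq> ?C" using ps qs by auto
    ultimately show ?case by blast
  next
    case (gen p)
    then show ?case using K.one_closed by (intro exI[of _ "[p]"]) auto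
  qed
  then show thesis
    using c sum_list_frag_closed coset_eq_iff that unfolding tensor_list_def by metis
qed

lemma tensor_group: "abelian_group AB"
proof -
  have "comm_group (F Mod K)"
    using F.abelian_FactGroup[OF K.subgroup_axioms] .
  then interpret Q: comm_group "F Mod K" .
  have ops: "carrier AB = carrier (F Mod K)" "x \<oplus>\<^bsub>AB\<^esub> y = x \<otimes>\<^bsub>F Mod K\<^esub> y" "\<zero>\<^bsub>AB\<^esub> = \<one>\<^bsub>F Mod K\<^esub>" for x y
    by (simp_all add: tensor_def Let_def)
  show ?thesis
  proof (rule abelian_groupI)
    show "\<exists>y\<in>carrier AB. y \<oplus>\<^bsub>AB\<^esub> x = \<zero>\<^bsub>AB\<^esub>" if "x \<in> carrier AB" for x
      using that unfolding ops by (intro bexI[of _ "inv\<^bsub>F Mod K\<^esub> x"] Q.l_inv Q.inv_closed)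
  qed (unfold ops; (rule Q.m_closed Q.one_closed Q.m_assoc Q.m_comm Q.l_one; assumption)?)+
qed

text \<open>The actions on a tensor product are unions over all representatives of a coset. If
  \<open>h\<close> respects the relators, every representative yields the same coset, so the union
  is that coset.\<close>

lemma frag_extend_image:
  assumes h: "\<And>p. p \<in> carrier A \<times> carrier B \<Longrightarrow> h p \<in> carrier A \<times> carrier B"
    and rel: "\<And>c. c \<in> relators \<Longrightarrow> frag_extend (\<lambda>p. frag_of (h p)) c \<in> K"
    and ps: "set ps \<subseteq> carrier A \<times> carrier B"
  shows "(\<Union>c\<in>tensor_list S A B ps. K #>\<^bsub>F\<^esub> frag_extend (\<lambda>p. frag_of (h p)) c) =
    tensor_list S A B (map h ps)"
proof -
  let ?e = "frag_extend (\<lambda>p. frag_of (h p))"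
  have e_K: "?e c \<in> K" if "c \<in> K" for c
    using that[unfolded K_eq]
  proof (induction rule: generate.induct)
    case one show ?case using K.one_closed by simp
  next
    case (incl c) then show ?case by (rule rel)
  next
    case (inv c)
    then have "c \<in> carrier F" using relators_in_F by blast
    then show ?case using K_minus[OF rel[OF inv]] by (simp add: frag_extend_minus)
  next
    case (eng c d) then show ?case using K_add by (simp add: frag_extend_add)
  qed
  have e_list: "?e (sum_list (map frag_of ps)) = sum_list (map frag_of (map h ps))"
    by (induction ps) (simp_all add: frag_extend_add)
  have hps: "set (map h ps) \<subseteq> carrier A \<times> carrier B"
    using h subsetD[OF ps] unfolding set_map image_subset_iff by blast
  \<comment> \<open>A representative differs from the listed sum by an element of \<open>K\<close>,
    and the extension of \<open>h\<close> keeps it in \<open>K\<close> by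
    \<open>e_K\<close>.\<close>
  have *: "K #>\<^bsub>F\<^esub> ?e c = tensor_list S A B (map h ps)" if c: "c \<in> tensor_list S A B ps" for c
  proof -
    obtain d where d: "d \<in> K" "c = d + sum_list (map frag_of ps)"
      using c by (auto simp: tensor_list_def r_coset_def)
    have "?e c = ?e d + sum_list (map frag_of (map h ps))"
      by (simp only: d(2) frag_extend_add e_list)
    moreover have "?e d \<in> carrier F" using K.mem_carrier e_K d(1) by blast
    ultimately show ?thesis unfolding tensor_list_def
      using e_K[OF d(1)] sum_list_frag_closed[OF hps]
      by (subst coset_eq_iff) (simp_all add: F_add_closed)
  qed
  \<comment> \<open>Nonemptiness matters: a union of a constant family equals its common value only
    over a nonempty index set.\<close>
  have "tensor_list S A B ps \<noteq> {}"
    unfolding tensor_list_def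
    using F.rcos_self[OF sum_list_frag_closed[OF ps] K.subgroup_axioms] by blast
  moreover have "(\<Union>c\<in>tensor_list S A B ps. K #>\<^bsub>F\<^esub> ?e c) =
      (\<Union>c\<in>tensor_list S A B ps. tensor_list S A B (map h ps))"
    by (rule SUP_cong) (simp_all only: *)
  ultimately show ?thesis by simp
qed

text \<open>Each relator goes to a relator of the same kind; for the balancing relators this is the
  commutation of the two actions on \<open>A\<close>.\<close>

lemma lact_tensor_list:
  assumes r: "r \<in> carrier R" and ps: "set ps \<subseteq> carrier A \<times> carrier B"
  shows "lact AB r (tensor_list S A B ps) = tensor_list S A B (map (\<lambda>(a, b). (lact A r a, b)) ps)"
proof -
  let ?h = "\<lambda>(a, b). (lact A r a, b)"
  have eq: "(\<lambda>(a, b). frag_of (lact A r a, b)) = (\<lambda>p. frag_of (?h p))" by auto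
  have "frag_extend (\<lambda>p. frag_of (?h p)) c \<in> K" if "c \<in> relators" for c
    using that by (cases rule: relators.cases)
      (use r in \<open>simp_all add: frag_extend_diff A.lact_add_right A.lact_ract[symmetric] A.lact_closed
        K_add_left K_add_right K_balanced\<close>)
  then show ?thesis
    unfolding tensor_simps eq using r ps by (intro frag_extend_image) (auto simp: A.lact_closed)
qed

lemma ract_tensor_list:
  assumes t: "t \<in> carrier T" and ps: "set ps \<subseteq> carrier A \<times> carrier B"
  shows "ract AB (tensor_list S A B ps) t = tensor_list S A B (map (\<lambda>(a, b). (a, ract B b t)) ps)"
proof -
  let ?h = "\<lambda>(a, b). (a, ract B b t)"
  have eq: "(\<lambda>(a, b). frag_of (a, ract B b t)) = (\<lambda>p. frag_of (?h p))" by auto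
  have "frag_extend (\<lambda>p. frag_of (?h p)) c \<in> K" if "c \<in> relators" for c
    using that by (cases rule: relators.cases)
      (use t in \<open>simp_all add: frag_extend_diff B.ract_add_left B.lact_ract B.ract_closed
        K_add_left K_add_right K_balanced\<close>)
  then show ?thesis
    unfolding tensor_simps eq using t ps by (intro frag_extend_image) (auto simp: B.ract_closed)
qed

section \<open>The universal property of the tensor product\<close>

lemma hom_kills_K:
  assumes G: "abelian_group G" and b: "balanced S A B G b"
    and h: "h \<in> hom F (add_monoid G)"
    and h_frag: "\<And>p. p \<in> carrier A \<times> carrier B \<Longrightarrow> h (frag_of p) = b (fst p) (snd p)"
    and c: "c \<in> K"
  shows "h c = \<zero>\<^bsub>G\<^esub>"
proof -
  interpret G: abelian_group G by fact
  interpret h: group_hom F "add_monoid G" h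
    using h by unfold_locales
  have h_diff: "h (x - y) = h x \<ominus>\<^bsub>G\<^esub> h y" if "x \<in> carrier F" "y \<in> carrier F" for x y
    using h.hom_mult[of x "inv\<^bsub>F\<^esub> y"] h.hom_inv[of y] that F.inv_closed[of y]
    by (simp add: a_minus_def a_inv_def del: h.hom_mult h.hom_inv)
  have hG: "h x \<in> carrier G" if "x \<in> carrier F" for x
    using h.hom_closed[OF that] by simp
  have cancel: "x \<oplus>\<^bsub>G\<^esub> y \<ominus>\<^bsub>G\<^esub> x \<ominus>\<^bsub>G\<^esub> y = \<zero>\<^bsub>G\<^esub>" if "x \<in> carrier G" "y \<in> carrier G" for x y
  proof -
    have "x \<oplus>\<^bsub>G\<^esub> y \<ominus>\<^bsub>G\<^esub> x \<ominus>\<^bsub>G\<^esub> y = (x \<oplus>\<^bsub>G\<^esub> y) \<ominus>\<^bsub>G\<^esub> (x \<oplus>\<^bsub>G\<^esub> y)"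
      using that by (simp add: a_minus_def G.minus_add G.a_assoc)
    then show ?thesis using that by (simp add: a_minus_def G.r_neg)
  qed
  \<comment> \<open>The three clauses on sums and scalars in \<open>balanced\<close> are exactly the
    vanishing of \<open>h\<close> on the three kinds of relators.\<close>
  have rel: "h c = \<zero>\<^bsub>G\<^esub>" if "c \<in> relators" for c
    using that by (cases rule: relators.cases)
      (use b in \<open>simp_all add: balanced_def h_diff h_frag F_diff_closed A.ract_closed B.lact_closed
        cancel a_minus_def[symmetric]\<close>, simp add: a_minus_def G.r_neg B.lact_closed)
  show ?thesis
    using c[unfolded K_eq]
  proof (induction rule: generate.induct)
    case one show ?case using h.hom_one by simp
  next
    case (incl c) then show ?case by (rule rel)
  next
    case (inv c)
    then have "c \<in> carrier F" using relators_in_F by blast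
    then have "h (inv\<^bsub>F\<^esub> c) = \<ominus>\<^bsub>G\<^esub> h c" using h.hom_inv[of c] by (simp only: a_inv_def)
    then show ?case using rel[OF inv] by simp
  next
    case (eng c d)
    then show ?case
      using h.hom_mult[of c d] F.generate_in_carrier[OF relators_in_F] by simp
  qed
qed

text \<open>The homomorphism stays on the free abelian group. It vanishes on \<open>K\<close>, hence
  is constant on cosets, which the last clause records in terms of lists.\<close>

lemma balanced_hom:
  assumes G: "abelian_group G" and b: "balanced S A B G b"
  obtains h where "h \<in> hom F (add_monoid G)"
    "\<forall>p\<in>carrier A \<times> carrier B. h (frag_of p) = b (fst p) (snd p)"
    "\<forall>ps. set ps \<subseteq> carrier A \<times> carrier B \<longrightarrow>
      (\<forall>c\<in>tensor_list S A B ps. h c = pair_sum G b ps)"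
proof -
  interpret G: abelian_group G by fact
  have "(\<lambda>p. b (fst p) (snd p)) ` (carrier A \<times> carrier B) \<subseteq> carrier (add_monoid G)"
    using b by (auto simp: balanced_def)
  from comm_group.free_Abelian_group_universal[OF G.a_comm_group this]
  obtain h where h: "h \<in> hom F (add_monoid G)"
    and h_frag: "\<And>p. p \<in> carrier A \<times> carrier B \<Longrightarrow> h (frag_of p) = b (fst p) (snd p)"
    unfolding tensor_free_def by blast
  have h_add: "h (c + d) = h c \<oplus>\<^bsub>G\<^esub> h d" if "c \<in> carrier F" "d \<in> carrier F" for c d
    using hom_mult[OF h that] by simp
  have h_closed: "h c \<in> carrier G" if "c \<in> carrier F" for c
    using hom_in_carrier[OF h that] by simp
  have coset: "h d = h c" if c: "c \<in> carrier F" and d: "d \<in> K #>\<^bsub>F\<^esub> c" for c d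
  proof -
    obtain x where x: "x \<in> K" "d = x + c" using d by (auto simp: r_coset_def)
    then show ?thesis
      using h_add[OF K.mem_carrier[OF x(1)] c] hom_kills_K[OF G b h h_frag x(1)] h_closed[OF c] by simp
  qed
  have "h (sum_list (map frag_of ps)) = pair_sum G b ps"
    if "set ps \<subseteq> carrier A \<times> carrier B" for ps
    using that
  proof (induction ps)
    case Nil
    have "h 0 = \<zero>\<^bsub>G\<^esub>"
      using hom_kills_K[OF G b h h_frag K.one_closed] by simp
    then show ?case by simp
  next
    case (Cons p ps)
    then show ?case
      using h_add[of "frag_of p" "sum_list (map frag_of ps)"] sum_list_frag_closed h_frag[of p] by simp
  qed
  then show thesis
    using that[OF h] h_frag coset[OF sum_list_frag_closed] by (simp add: tensor_list_def)
qed

text \<open>The passage from equations between cosets to the tested equations of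
  \<open>left_quasibase\<close> and \<open>separability_element\<close>.\<close>

lemma pair_sum_eq_if_tensor_list_eq:
  assumes G: "abelian_group G" and b: "balanced S A B G b"
    and ps: "set ps \<subseteq> carrier A \<times> carrier B" and qs: "set qs \<subseteq> carrier A \<times> carrier B"
    and eq: "tensor_list S A B ps = tensor_list S A B qs"
  shows "pair_sum G b ps = pair_sum G b qs"
proof -
  obtain h where h: "\<forall>ps. set ps \<subseteq> carrier A \<times> carrier B \<longrightarrow>
      (\<forall>c\<in>tensor_list S A B ps. h c = pair_sum G b ps)"
    by (rule balanced_hom[OF G b])
  have "sum_list (map frag_of ps) \<in> tensor_list S A B ps"
    using F.rcos_self[OF sum_list_frag_closed[OF ps] K.subgroup_axioms] by (simp add: tensor_list_def)
  then show ?thesis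
    using h ps qs eq by metis
qed

end

text \<open>Brings a homomorphism into the shape used in \<open>mult_map\<close>, a sum over the
  support weighted by integer coefficients.\<close>

lemma hom_free_Abelian_group_expand:
  assumes G: "abelian_group G" and h: "h \<in> hom (free_Abelian_group S) (add_monoid G)"
    and c: "Poly_Mapping.keys c \<subseteq> S"
  shows "h c = (\<Oplus>\<^bsub>G\<^esub>p\<in>Poly_Mapping.keys c. [Poly_Mapping.lookup c p] \<cdot>\<^bsub>G\<^esub> h (frag_of p))"
proof -
  interpret G: abelian_group G by fact
  interpret F: group "free_Abelian_group S" by simp
  interpret h: group_hom "free_Abelian_group S" "add_monoid G" h
    using h by unfold_locales
  have cmul: "h (frag_cmul n (frag_of p)) = [n] \<cdot>\<^bsub>G\<^esub> h (frag_of p)" if "p \<in> S" for n :: int and p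
    using h.hom_int_pow[of "frag_of p" n] that int_pow_free_Abelian_group[of "frag_of p" S n]
    by (simp add: add_pow_def)
  have closed: "frag_cmul n (frag_of p) \<in> carrier (free_Abelian_group S)" if "p \<in> S" for n p
    using that keys_cmul[of n "frag_of p"] by auto
  have hclosed: "[n] \<cdot>\<^bsub>G\<^esub> h (frag_of p) \<in> carrier G" if "p \<in> S" for n :: int and p
    using h.hom_closed[OF closed[OF that]] cmul[OF that] by simp
  have sum: "h (\<Sum>p\<in>I. frag_cmul (n p) (frag_of p)) = (\<Oplus>\<^bsub>G\<^esub>p\<in>I. [n p] \<cdot>\<^bsub>G\<^esub> h (frag_of p))"
    if "finite I" "I \<subseteq> S" for I n
    using that
  proof (induction I)
    case empty
    then show ?case using h.hom_one by simp
  next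
    case (insert p I)
    then have p: "p \<in> S" and I: "I \<subseteq> S" by auto
    have "(\<Sum>p\<in>I. frag_cmul (n p) (frag_of p)) \<in> carrier (free_Abelian_group S)"
      by (rule sum_closed_free_Abelian_group) (use closed I in blast)
    then have "h (frag_cmul (n p) (frag_of p) + (\<Sum>p\<in>I. frag_cmul (n p) (frag_of p))) =
        [n p] \<cdot>\<^bsub>G\<^esub> h (frag_of p) \<oplus>\<^bsub>G\<^esub> h (\<Sum>p\<in>I. frag_cmul (n p) (frag_of p))"
      using h.hom_mult[OF closed[OF p]] cmul[OF p] by simp
    moreover have "(\<Oplus>\<^bsub>G\<^esub>p\<in>insert p I. [n p] \<cdot>\<^bsub>G\<^esub> h (frag_of p)) =
        [n p] \<cdot>\<^bsub>G\<^esub> h (frag_of p) \<oplus>\<^bsub>G\<^esub> (\<Oplus>\<^bsub>G\<^esub>p\<in>I. [n p] \<cdot>\<^bsub>G\<^esub> h (frag_of p))"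
      using insert.hyps p I by (intro G.finsum_insert) (auto intro!: hclosed)
    ultimately show ?case using insert by simp
  qed
  have "h c = h (\<Sum>p\<in>Poly_Mapping.keys c. frag_cmul (Poly_Mapping.lookup c p) (frag_of p))"
    by (rule arg_cong[OF frag_expansion[unfolded frag_extend_def]])
  also have "\<dots> = (\<Oplus>\<^bsub>G\<^esub>p\<in>Poly_Mapping.keys c. [Poly_Mapping.lookup c p] \<cdot>\<^bsub>G\<^esub> h (frag_of p))"
    by (rule sum[OF finite_keys c])
  finally show ?thesis .
qed

text \<open>Multiplication is balanced, so the sum inside \<open>mult_map\<close> has the same value
  at every representative. The set given to \<open>the_elem\<close> is then a singleton.\<close>

lemma mult_map_tensor_list:
  assumes "tensor_modules R N T (ring_bimod M g f) (ring_bimod M f' h)"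
    and M: "ring M" and f: "\<And>r. r \<in> carrier N \<Longrightarrow> f r \<in> carrier M \<and> f' r = f r"
    and ps: "set ps \<subseteq> carrier M \<times> carrier M"
  shows "mult_map M (tensor_list N (ring_bimod M g f) (ring_bimod M f' h) ps) =
    pair_sum M (\<lambda>x y. x \<otimes>\<^bsub>M\<^esub> y) ps"
proof -
  interpret tensor_modules R N T "ring_bimod M g f" "ring_bimod M f' h" by fact
  interpret M: ring M by fact
  have carrier: "carrier (ring_bimod M g f) = carrier M" "carrier (ring_bimod M f' h) = carrier M"
    by (simp_all add: ring_bimod_def)
  have "balanced N (ring_bimod M g f) (ring_bimod M f' h) M (\<lambda>x y. x \<otimes>\<^bsub>M\<^esub> y)"
    using f by (simp add: balanced_def ring_bimod_def M.l_distr M.r_distr M.m_assoc)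
  then obtain k where k: "k \<in> hom F (add_monoid M)"
    "\<forall>p\<in>carrier M \<times> carrier M. k (frag_of p) = fst p \<otimes>\<^bsub>M\<^esub> snd p"
    and k_list: "\<forall>ps. set ps \<subseteq> carrier M \<times> carrier M \<longrightarrow>
      (\<forall>c\<in>tensor_list N (ring_bimod M g f) (ring_bimod M f' h) ps. k c = pair_sum M (\<lambda>x y. x \<otimes>\<^bsub>M\<^esub> y) ps)"
    by (rule balanced_hom[OF M.abelian_group_axioms, unfolded carrier])
  let ?X = "tensor_list N (ring_bimod M g f) (ring_bimod M f' h) ps"
  let ?s = "sum_list (map frag_of ps)"
  have s: "?s \<in> carrier F" using ps by (simp add: sum_list_frag_closed carrier)
  have "(\<Oplus>\<^bsub>M\<^esub>p\<in>Poly_Mapping.keys c. [Poly_Mapping.lookup c p] \<cdot>\<^bsub>M\<^esub> (fst p \<otimes>\<^bsub>M\<^esub> snd p)) =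
      pair_sum M (\<lambda>x y. x \<otimes>\<^bsub>M\<^esub> y) ps" if c: "c \<in> ?X" for c
  proof -
    have "c \<in> carrier F"
      using c K.elemrcos_carrier[OF F.is_group s] by (simp add: tensor_list_def)
    then have keys: "Poly_Mapping.keys c \<subseteq> carrier M \<times> carrier M"
      by (simp add: carrier_F carrier)
    have "k c = (\<Oplus>\<^bsub>M\<^esub>p\<in>Poly_Mapping.keys c. [Poly_Mapping.lookup c p] \<cdot>\<^bsub>M\<^esub> k (frag_of p))"
      using hom_free_Abelian_group_expand[OF M.abelian_group_axioms k(1)[unfolded tensor_free_def carrier] keys] .
    also have "\<dots> = (\<Oplus>\<^bsub>M\<^esub>p\<in>Poly_Mapping.keys c. [Poly_Mapping.lookup c p] \<cdot>\<^bsub>M\<^esub> (fst p \<otimes>\<^bsub>M\<^esub> snd p))"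
      using keys k(2) by (intro M.finsum_cong') (auto intro!: M.add.int_pow_closed simp: subset_iff)
    finally show ?thesis
      using k_list ps c by simp
  qed
  moreover have "?X \<noteq> {}"
    unfolding tensor_list_def using F.rcos_self[OF s K.subgroup_axioms] by blast
  ultimately have "(\<lambda>c. \<Oplus>\<^bsub>M\<^esub>p\<in>Poly_Mapping.keys c.
      [Poly_Mapping.lookup c p] \<cdot>\<^bsub>M\<^esub> (fst p \<otimes>\<^bsub>M\<^esub> snd p)) ` ?X = {pair_sum M (\<lambda>x y. x \<otimes>\<^bsub>M\<^esub> y) ps}"
    by (auto simp: image_iff)
  then show ?thesis unfolding mult_map_def by simp
qed

context tensor_modules
begin

lemma lact_tensor_closed:
  assumes "r \<in> carrier R" "X \<in> carrier AB"
  shows "lact AB r X \<in> carrier AB"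
proof -
  obtain ps where ps: "set ps \<subseteq> carrier A \<times> carrier B" "X = tensor_list S A B ps"
    using assms(2) by (rule tensor_list_surj)
  then have "set (map (\<lambda>(a, b). (lact A r a, b)) ps) \<subseteq> carrier A \<times> carrier B"
    using assms(1) A.lact_closed by auto
  then show ?thesis
    using tensor_list_closed by (simp add: ps(2) lact_tensor_list[OF assms(1) ps(1)])
qed

lemma ract_tensor_closed:
  assumes "t \<in> carrier T" "X \<in> carrier AB"
  shows "ract AB X t \<in> carrier AB"
proof -
  obtain ps where ps: "set ps \<subseteq> carrier A \<times> carrier B" "X = tensor_list S A B ps"
    using assms(2) by (rule tensor_list_surj)
  then have "set (map (\<lambda>(a, b). (a, ract B b t)) ps) \<subseteq> carrier A \<times> carrier B"
    using assms(1) B.ract_closed by auto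
  then show ?thesis
    using tensor_list_closed by (simp add: ps(2) ract_tensor_list[OF assms(1) ps(1)])
qed

lemma tensor_list_concat:
  assumes "\<And>i. i \<in> set xs \<Longrightarrow> set (q i) \<subseteq> carrier A \<times> carrier B"
  shows "tensor_list S A B (concat (map q xs)) = list_sum AB (\<lambda>i. tensor_list S A B (q i)) xs"
  using assms
proof (induction xs)
  case (Cons x xs)
  then have "set (concat (map q xs)) \<subseteq> carrier A \<times> carrier B" by fastforce
  then show ?case using Cons by (simp add: tensor_list_append)
qed (simp add: tensor_list_Nil)

end

section \<open>Quasibases, separability elements and splittings\<close>

lemma ring_hom_ring_id: "ring R \<Longrightarrow> ring_hom_ring R R id"
  by (rule ring_hom_ringI) auto

lemma balanced_ring_bimod:
  "balanced N (ring_bimod M g f) (ring_bimod M f h) M b \<longleftrightarrow> ring_balanced N M f b"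
  by (simp add: balanced_def ring_balanced_def ring_bimod_def)

lemma ring_bimod_simps:
  "carrier (ring_bimod M f g) = carrier M"
  "x \<oplus>\<^bsub>ring_bimod M f g\<^esub> y = x \<oplus>\<^bsub>M\<^esub> y"
  "lact (ring_bimod M f g) r x = f r \<otimes>\<^bsub>M\<^esub> x"
  "ract (ring_bimod M f g) x s = x \<otimes>\<^bsub>M\<^esub> g s"
  by (simp_all add: ring_bimod_def)

lemma tensor_modules_ring_bimod:
  assumes "ring_hom_ring R M g" "ring_hom_ring N M f" "ring_hom_ring T M h"
  shows "tensor_modules R N T (ring_bimod M g f) (ring_bimod M f h)"
  using assms by (intro tensor_modules.intro bimodule_ring_bimod)

section \<open>Opposite rings\<close>

definition op_ring :: "('a, 'k) ring_scheme \<Rightarrow> ('a, 'k) ring_scheme" where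
  "op_ring R = R\<lparr>mult := \<lambda>x y. y \<otimes>\<^bsub>R\<^esub> x\<rparr>"

lemma op_ring_simps [simp]:
  "carrier (op_ring R) = carrier R" "x \<otimes>\<^bsub>op_ring R\<^esub> y = y \<otimes>\<^bsub>R\<^esub> x" "\<one>\<^bsub>op_ring R\<^esub> = \<one>\<^bsub>R\<^esub>"
  "\<zero>\<^bsub>op_ring R\<^esub> = \<zero>\<^bsub>R\<^esub>" "x \<oplus>\<^bsub>op_ring R\<^esub> y = x \<oplus>\<^bsub>R\<^esub> y"
  by (simp_all add: op_ring_def)

lemma ring_op_ring:
  assumes "ring R"
  shows "ring (op_ring R)"
proof -
  interpret ring R by fact
  have "abelian_group (op_ring R)"
  proof (rule abelian_groupI)
    show "\<exists>y\<in>carrier (op_ring R). y \<oplus>\<^bsub>op_ring R\<^esub> x = \<zero>\<^bsub>op_ring R\<^esub>" if "x \<in> carrier (op_ring R)" for x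
      using that by (intro bexI[of _ "\<ominus>\<^bsub>R\<^esub> x"]) (simp_all add: l_neg)
  qed (simp_all add: a_ac)
  then show ?thesis
    by (rule ringI) (auto intro!: monoidI simp: m_assoc l_distr r_distr)
qed

lemma ring_hom_ring_op:
  assumes "ring_hom_ring N M f"
  shows "ring_hom_ring (op_ring N) (op_ring M) f"
proof -
  interpret ring_hom_ring N M f by fact
  show ?thesis
    by (rule ring_hom_ringI) (simp_all add: ring_op_ring R.ring_axioms S.ring_axioms)
qed

lemma list_sum_op_ring [simp]: "list_sum (op_ring R) = list_sum R"
  by (simp add: list_sum_def fun_eq_iff)

text \<open>Passing to opposite rings interchanges the two tensor factors.\<close>

lemma ring_balanced_op:
  "ring_balanced (op_ring N) (op_ring M) f b \<longleftrightarrow> ring_balanced N M f (\<lambda>x y. b y x)"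
  unfolding ring_balanced_def op_ring_simps by (intro iffI conjI ballI) simp_all

text \<open>Right linearity over \<open>M\<close> determines the maps \<open>v i\<close> by their
  values at the unit and the maps \<open>u i\<close> by their values on pure tensors with second
  factor the unit. The former give \<open>t i\<close>, the latter \<open>\<beta> i\<close>, and the
  sum formula for the retraction becomes \<open>t_dual\<close>.\<close>

lemma left_quasibase_if_left_D2:
  assumes hom: "ring_hom_ring N M f" and D2: "left_D2 N M f"
  obtains k t \<beta> where "k \<ge> 1" "left_quasibase N M f k t \<beta>"
proof -
  interpret ring_hom_ring N M f by fact
  have id: "ring_hom_ring M M id" by (rule ring_hom_ring_id) (rule S.ring_axioms)
  let ?A = "ring_bimod M f f" and ?B = "ring_bimod M f id"
  interpret tensor_modules N N M ?A ?B
    by (rule tensor_modules_ring_bimod[OF hom hom id])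
  let ?TL = "tensor_list N ?A ?B"
  obtain k :: nat where k: "k \<ge> 1" and summand: "bimod_summand N M AB (copies {..<k} ?B)"
    using D2 unfolding left_D2_def by blast
  note [simp] = ring_bimod_simps
  obtain u v where "\<forall>i<k. u i \<in> bimod_hom N M AB ?B" "\<forall>i<k. v i \<in> bimod_hom N M ?B AB"
    and vu: "\<forall>X\<in>carrier AB. list_sum AB (\<lambda>i. v i (u i X)) [0..<k] = X"
    by (rule bimod_summand_copiesE[OF tensor_group lact_tensor_closed ract_tensor_closed
      bimodule_ring_bimod[OF hom id] summand])
  then have u: "\<And>i. i < k \<Longrightarrow> u i \<in> bimod_hom N M AB ?B"
    and v: "\<And>i. i < k \<Longrightarrow> v i \<in> bimod_hom N M ?B AB" by auto
  have "\<exists>ps. set ps \<subseteq> carrier M \<times> carrier M \<and> v i \<one>\<^bsub>M\<^esub> = ?TL ps" if "i < k" for i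
  proof -
    have "v i \<one>\<^bsub>M\<^esub> \<in> carrier AB" using bimod_hom_closed[OF v[OF that]] by simp
    then show ?thesis by (rule tensor_list_surj) auto
  qed
  then obtain t where t: "\<And>i. i < k \<Longrightarrow> set (t i) \<subseteq> carrier M \<times> carrier M"
    and v_one: "\<And>i. i < k \<Longrightarrow> v i \<one>\<^bsub>M\<^esub> = ?TL (t i)"
    by metis
  define \<beta> where "\<beta> i x = u i (?TL [(x, \<one>\<^bsub>M\<^esub>)])" for i x
  have TL_closed: "?TL [(x, y)] \<in> carrier AB" if "x \<in> carrier M" "y \<in> carrier M" for x y
    using that by (intro tensor_list_closed) simp
  have v_eq: "v i m = ?TL (map (\<lambda>(a, c). (a, c \<otimes>\<^bsub>M\<^esub> m)) (t i))" if "i < k" "m \<in> carrier M" for i m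
    using bimod_hom_ract[OF v[OF that(1)], of m "\<one>\<^bsub>M\<^esub>"] that t[OF that(1)]
    by (simp add: v_one ract_tensor_list)
  have u_eq: "u i (?TL [(x, y)]) = \<beta> i x \<otimes>\<^bsub>M\<^esub> y" if "i < k" "x \<in> carrier M" "y \<in> carrier M" for i x y
    using bimod_hom_ract[OF u[OF that(1)] _ TL_closed[OF that(2) S.one_closed], of y] that
    by (simp add: \<beta>_def ract_tensor_list)
  have "left_quasibase N M f k t \<beta>"
  proof
    fix i assume i: "i < k"
    show "set (t i) \<subseteq> carrier M \<times> carrier M" by (rule t[OF i])
    show "\<beta> i x \<in> carrier M" if "x \<in> carrier M" for x
      unfolding \<beta>_def using bimod_hom_closed[OF u[OF i] TL_closed[OF that S.one_closed]] by simp
    show "\<beta> i (x \<oplus>\<^bsub>M\<^esub> y) = \<beta> i x \<oplus>\<^bsub>M\<^esub> \<beta> i y" if "x \<in> carrier M" "y \<in> carrier M" for x y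
      unfolding \<beta>_def using that tensor_rel_add_left[of x y "\<one>\<^bsub>M\<^esub>"]
        tensor_list_append[of "[(x, \<one>\<^bsub>M\<^esub>)]" "[(y, \<one>\<^bsub>M\<^esub>)]"] bimod_hom_add[OF u[OF i]] TL_closed
      by simp
    show "\<beta> i (f r \<otimes>\<^bsub>M\<^esub> x) = f r \<otimes>\<^bsub>M\<^esub> \<beta> i x" if "r \<in> carrier N" "x \<in> carrier M" for r x
      unfolding \<beta>_def using that lact_tensor_list[of r "[(x, \<one>\<^bsub>M\<^esub>)]"]
        bimod_hom_lact[OF u[OF i] that(1) TL_closed[OF that(2) S.one_closed]] by simp
    \<comment> \<open>The scalar crosses the tensor sign and then leaves by right linearity of
      \<open>u i\<close>.\<close>
    show "\<beta> i (x \<otimes>\<^bsub>M\<^esub> f r) = \<beta> i x \<otimes>\<^bsub>M\<^esub> f r" if "r \<in> carrier N" "x \<in> carrier M" for r x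
    proof -
      have "\<beta> i (x \<otimes>\<^bsub>M\<^esub> f r) = u i (?TL [(x, f r)])"
        unfolding \<beta>_def using that tensor_rel_balanced[of x r "\<one>\<^bsub>M\<^esub>"] by simp
      then show ?thesis using u_eq[OF i that(2), of "f r"] that by simp
    qed
    show "pair_sum M (\<lambda>x y. b (f r \<otimes>\<^bsub>M\<^esub> x) y) (t i) = pair_sum M (\<lambda>x y. b x (y \<otimes>\<^bsub>M\<^esub> f r)) (t i)"
      if r: "r \<in> carrier N" and b: "ring_balanced N M f b" for r b
    proof -
      let ?l = "map (\<lambda>(a, c). (f r \<otimes>\<^bsub>M\<^esub> a, c)) (t i)" and ?r = "map (\<lambda>(a, c). (a, c \<otimes>\<^bsub>M\<^esub> f r)) (t i)"
      \<comment> \<open>Multiplying the tensor of \<open>t i\<close> by \<open>f r\<close> on either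
        side gives \<open>v i (f r)\<close>, because \<open>v i\<close> is linear on both
        sides.\<close>
      have "?TL ?l = v i (f r)"
        using bimod_hom_lact[OF v[OF i] r, of "\<one>\<^bsub>M\<^esub>"] lact_tensor_list[OF r, of "t i"] t[OF i] r
        by (simp add: v_one[OF i])
      then have "?TL ?l = ?TL ?r" using v_eq[OF i, of "f r"] r by simp
      moreover have "set ?l \<subseteq> carrier M \<times> carrier M" "set ?r \<subseteq> carrier M \<times> carrier M"
        using t[OF i] r by auto
      ultimately have "pair_sum M b ?l = pair_sum M b ?r"
        using b by (intro pair_sum_eq_if_tensor_list_eq) (simp_all add: balanced_ring_bimod S.abelian_group_axioms)
      then show ?thesis by (simp add: case_prod_beta)
    qed
  next
    fix x y b assume x: "x \<in> carrier M" and y: "y \<in> carrier M" and b: "ring_balanced N M f b"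
    let ?q = "\<lambda>i. map (\<lambda>(a, c). (a, c \<otimes>\<^bsub>M\<^esub> (\<beta> i x \<otimes>\<^bsub>M\<^esub> y))) (t i)"
    have \<beta>: "\<beta> i x \<in> carrier M" if "i < k" for i
      unfolding \<beta>_def using bimod_hom_closed[OF u[OF that] TL_closed[OF x S.one_closed]] by simp
    have q: "set (?q i) \<subseteq> carrier M \<times> carrier M" if "i \<in> set [0..<k]" for i
      using t[of i] \<beta>[of i] y that by fastforce
    have "(\<Union>i\<in>set [0..<k]. set (?q i)) \<subseteq> carrier M \<times> carrier M"
      by (rule UN_least[OF q])
    then have Q: "set (concat (map ?q [0..<k])) \<subseteq> carrier M \<times> carrier M"
      by simp
    have "?TL [(x, y)] = list_sum AB (\<lambda>i. v i (u i (?TL [(x, y)]))) [0..<k]"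
      using vu TL_closed[OF x y] by simp
    also have "\<dots> = list_sum AB (\<lambda>i. ?TL (?q i)) [0..<k]"
      using x y \<beta> by (intro list_sum_cong) (simp add: u_eq v_eq)
    also have "\<dots> = ?TL (concat (map ?q [0..<k]))"
      using tensor_list_concat[of "[0..<k]" ?q] q by simp
    finally have "pair_sum M b [(x, y)] = pair_sum M b (concat (map ?q [0..<k]))"
      using Q x y b
      by (intro pair_sum_eq_if_tensor_list_eq)
        (simp_all add: balanced_ring_bimod S.abelian_group_axioms)
    also have "\<dots> = list_sum M (\<lambda>i. pair_sum M b (?q i)) [0..<k]"
    proof -
      have "b (fst p) (snd p) \<in> carrier M" if "p \<in> set (?q i)" "i \<in> set [0..<k]" for i p
        using subsetD[OF q[OF that(2)] that(1)] b by (simp add: ring_balanced_def mem_Times_iff)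
      then show ?thesis by (subst S.list_sum_concat) auto
    qed
    finally show "list_sum M (\<lambda>i. pair_sum M (\<lambda>a c. b a (c \<otimes>\<^bsub>M\<^esub> (\<beta> i x \<otimes>\<^bsub>M\<^esub> y))) (t i)) [0..<k] = b x y"
      using b x y by (simp add: case_prod_beta ring_balanced_def)
  qed
  then show thesis using that k by blast
qed

text \<open>The mirror image of the preceding construction, with \<open>\<gamma> i x\<close> the
  value of \<open>u i\<close> at the pure tensor of the unit and \<open>x\<close>. It is carried out
  over \<open>N\<close> itself, and only the resulting identities are read over the opposite rings,
  so tensor products over different rings need not be compared.\<close>

lemma left_quasibase_op_if_right_D2:
  assumes hom: "ring_hom_ring N M f" and D2: "right_D2 N M f"
  obtains k t \<gamma> where "k \<ge> 1" "left_quasibase (op_ring N) (op_ring M) f k t \<gamma>"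
proof -
  interpret ring_hom_ring N M f by fact
  have id: "ring_hom_ring M M id" by (rule ring_hom_ring_id) (rule S.ring_axioms)
  let ?A = "ring_bimod M id f" and ?B = "ring_bimod M f f"
  interpret tensor_modules M N N ?A ?B
    by (rule tensor_modules_ring_bimod[OF id hom hom])
  let ?TL = "tensor_list N ?A ?B"
  obtain k :: nat where k: "k \<ge> 1" and summand: "bimod_summand M N AB (copies {..<k} ?A)"
    using D2 unfolding right_D2_def by blast
  note [simp] = ring_bimod_simps
  obtain u v where "\<forall>i<k. u i \<in> bimod_hom M N AB ?A" "\<forall>i<k. v i \<in> bimod_hom M N ?A AB"
    and vu: "\<forall>X\<in>carrier AB. list_sum AB (\<lambda>i. v i (u i X)) [0..<k] = X"
    by (rule bimod_summand_copiesE[OF tensor_group lact_tensor_closed ract_tensor_closed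
      bimodule_ring_bimod[OF id hom] summand])
  then have u: "\<And>i. i < k \<Longrightarrow> u i \<in> bimod_hom M N AB ?A"
    and v: "\<And>i. i < k \<Longrightarrow> v i \<in> bimod_hom M N ?A AB" by auto
  have "\<exists>ps. set ps \<subseteq> carrier M \<times> carrier M \<and> v i \<one>\<^bsub>M\<^esub> = ?TL ps" if "i < k" for i
  proof -
    have "v i \<one>\<^bsub>M\<^esub> \<in> carrier AB" using bimod_hom_closed[OF v[OF that]] by simp
    then show ?thesis by (rule tensor_list_surj) auto
  qed
  then obtain t where t: "\<And>i. i < k \<Longrightarrow> set (t i) \<subseteq> carrier M \<times> carrier M"
    and v_one: "\<And>i. i < k \<Longrightarrow> v i \<one>\<^bsub>M\<^esub> = ?TL (t i)"
    by metis
  define \<gamma> where "\<gamma> i x = u i (?TL [(\<one>\<^bsub>M\<^esub>, x)])" for i x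
  have TL_closed: "?TL [(x, y)] \<in> carrier AB" if "x \<in> carrier M" "y \<in> carrier M" for x y
    using that by (intro tensor_list_closed) simp
  have v_eq: "v i m = ?TL (map (\<lambda>(a, c). (m \<otimes>\<^bsub>M\<^esub> a, c)) (t i))" if "i < k" "m \<in> carrier M" for i m
    using bimod_hom_lact[OF v[OF that(1)], of m "\<one>\<^bsub>M\<^esub>"] that t[OF that(1)]
    by (simp add: v_one lact_tensor_list)
  have u_eq: "u i (?TL [(x, y)]) = x \<otimes>\<^bsub>M\<^esub> \<gamma> i y" if "i < k" "x \<in> carrier M" "y \<in> carrier M" for i x y
    using bimod_hom_lact[OF u[OF that(1)] _ TL_closed[OF S.one_closed that(3)], of x] that
    by (simp add: \<gamma>_def lact_tensor_list)
  have \<gamma>_closed: "\<gamma> i x \<in> carrier M" if "i < k" "x \<in> carrier M" for i x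
    unfolding \<gamma>_def using bimod_hom_closed[OF u[OF that(1)] TL_closed[OF S.one_closed that(2)]] by simp
  have \<gamma>_add: "\<gamma> i (x \<oplus>\<^bsub>M\<^esub> y) = \<gamma> i x \<oplus>\<^bsub>M\<^esub> \<gamma> i y" if i: "i < k" and "x \<in> carrier M" "y \<in> carrier M" for i x y
    unfolding \<gamma>_def using that tensor_rel_add_right[of "\<one>\<^bsub>M\<^esub>" x y]
      tensor_list_append[of "[(\<one>\<^bsub>M\<^esub>, x)]" "[(\<one>\<^bsub>M\<^esub>, y)]"] bimod_hom_add[OF u[OF i]] TL_closed
    by simp
  have \<gamma>_right: "\<gamma> i (x \<otimes>\<^bsub>M\<^esub> f r) = \<gamma> i x \<otimes>\<^bsub>M\<^esub> f r" if i: "i < k" and "r \<in> carrier N" "x \<in> carrier M" for i r x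
    unfolding \<gamma>_def using that ract_tensor_list[of r "[(\<one>\<^bsub>M\<^esub>, x)]"]
      bimod_hom_ract[OF u[OF i] that(2) TL_closed[OF S.one_closed that(3)]] by simp
  have \<gamma>_left: "\<gamma> i (f r \<otimes>\<^bsub>M\<^esub> x) = f r \<otimes>\<^bsub>M\<^esub> \<gamma> i x" if i: "i < k" and "r \<in> carrier N" "x \<in> carrier M" for i r x
  proof -
    have "\<gamma> i (f r \<otimes>\<^bsub>M\<^esub> x) = u i (?TL [(f r, x)])"
      unfolding \<gamma>_def using that tensor_rel_balanced[of "\<one>\<^bsub>M\<^esub>" r x] by simp
    then show ?thesis using u_eq[OF i _ that(3), of "f r"] that by simp
  qed
  have t_comm: "pair_sum M (\<lambda>x y. b (f r \<otimes>\<^bsub>M\<^esub> x) y) (t i) = pair_sum M (\<lambda>x y. b x (y \<otimes>\<^bsub>M\<^esub> f r)) (t i)"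
    if i: "i < k" and r: "r \<in> carrier N" and b: "ring_balanced N M f b" for i r b
  proof -
    let ?l = "map (\<lambda>(a, c). (f r \<otimes>\<^bsub>M\<^esub> a, c)) (t i)" and ?r = "map (\<lambda>(a, c). (a, c \<otimes>\<^bsub>M\<^esub> f r)) (t i)"
    have "?TL ?r = v i (f r)"
      using bimod_hom_ract[OF v[OF i] r, of "\<one>\<^bsub>M\<^esub>"] ract_tensor_list[OF r, of "t i"] t[OF i] r
      by (simp add: v_one[OF i])
    then have "?TL ?l = ?TL ?r" using v_eq[OF i, of "f r"] r by simp
    moreover have "set ?l \<subseteq> carrier M \<times> carrier M" "set ?r \<subseteq> carrier M \<times> carrier M"
      using t[OF i] r by auto
    ultimately have "pair_sum M b ?l = pair_sum M b ?r"
      using b by (intro pair_sum_eq_if_tensor_list_eq) (simp_all add: balanced_ring_bimod S.abelian_group_axioms)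
    then show ?thesis by (simp add: case_prod_beta)
  qed
  have t_dual: "list_sum M (\<lambda>i. pair_sum M (\<lambda>a c. b (y \<otimes>\<^bsub>M\<^esub> \<gamma> i x \<otimes>\<^bsub>M\<^esub> a) c) (t i)) [0..<k] = b y x"
    if x: "x \<in> carrier M" and y: "y \<in> carrier M" and b: "ring_balanced N M f b" for x y b
  proof -
    let ?q = "\<lambda>i. map (\<lambda>(a, c). (y \<otimes>\<^bsub>M\<^esub> \<gamma> i x \<otimes>\<^bsub>M\<^esub> a, c)) (t i)"
    have q: "set (?q i) \<subseteq> carrier M \<times> carrier M" if "i \<in> set [0..<k]" for i
      using t[of i] \<gamma>_closed[of i] x y that by fastforce
    have "(\<Union>i\<in>set [0..<k]. set (?q i)) \<subseteq> carrier M \<times> carrier M"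
      by (rule UN_least[OF q])
    then have Q: "set (concat (map ?q [0..<k])) \<subseteq> carrier M \<times> carrier M"
      by simp
    have "?TL [(y, x)] = list_sum AB (\<lambda>i. v i (u i (?TL [(y, x)]))) [0..<k]"
      using vu TL_closed[OF y x] by simp
    also have "\<dots> = list_sum AB (\<lambda>i. ?TL (?q i)) [0..<k]"
      using x y \<gamma>_closed by (intro list_sum_cong) (simp add: u_eq v_eq)
    also have "\<dots> = ?TL (concat (map ?q [0..<k]))"
      using tensor_list_concat[of "[0..<k]" ?q] q by simp
    finally have "pair_sum M b [(y, x)] = pair_sum M b (concat (map ?q [0..<k]))"
      using Q x y b
      by (intro pair_sum_eq_if_tensor_list_eq)
        (simp_all add: balanced_ring_bimod S.abelian_group_axioms)
    also have "\<dots> = list_sum M (\<lambda>i. pair_sum M b (?q i)) [0..<k]"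
    proof -
      have "b (fst p) (snd p) \<in> carrier M" if "p \<in> set (?q i)" "i \<in> set [0..<k]" for i p
        using subsetD[OF q[OF that(2)] that(1)] b by (simp add: ring_balanced_def mem_Times_iff)
      then show ?thesis by (subst S.list_sum_concat) auto
    qed
    finally show ?thesis
      using b x y by (simp add: case_prod_beta ring_balanced_def)
  qed
  \<comment> \<open>The pairs in \<open>t i\<close> are swapped, test maps have their arguments
    exchanged, and left and right linearity of \<open>\<gamma>\<close> trade places.\<close>
  have "left_quasibase (op_ring N) (op_ring M) f k (\<lambda>i. map prod.swap (t i)) \<gamma>"
  proof (intro left_quasibase.intro ring_hom_ring_op hom left_quasibase_axioms.intro, goal_cases)
    case (1 i) then show ?case using t by fastforce
  next
    case (6 i r b)
    then show ?case using t_comm[of i r "\<lambda>x y. b y x"] by (simp add: ring_balanced_op)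
  next
    case (7 x y b)
    then show ?case using t_dual[of x y "\<lambda>x y. b y x"] by (simp add: ring_balanced_op)
  qed (simp_all add: \<gamma>_closed \<gamma>_add \<gamma>_right \<gamma>_left)
  then show thesis using that k by blast
qed

text \<open>\<open>e\<close> represents the image of the unit under the section
  \<open>\<sigma>\<close>; its product is the unit because \<open>\<sigma>\<close> splits
  multiplication.\<close>

lemma separability_element_if_separable:
  assumes hom: "ring_hom_ring N M f" and sep: "separable_extension N M f"
  obtains e where "separability_element N M f e"
proof -
  interpret ring_hom_ring N M f by fact
  have id: "ring_hom_ring M M id" by (rule ring_hom_ring_id) (rule S.ring_axioms)
  let ?A = "ring_bimod M id f" and ?B = "ring_bimod M f id" and ?C = "ring_bimod M id id"
  have TM: "tensor_modules M N M ?A ?B"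
    by (rule tensor_modules_ring_bimod[OF id hom id])
  interpret tensor_modules M N M ?A ?B by (rule TM)
  note [simp] = ring_bimod_simps
  obtain \<sigma> where \<sigma>: "\<sigma> \<in> bimod_hom M M ?C AB" and mult: "\<forall>x\<in>carrier M. mult_map M (\<sigma> x) = x"
    using sep unfolding separable_extension_def by blast
  have "\<sigma> \<one>\<^bsub>M\<^esub> \<in> carrier AB" using bimod_hom_closed[OF \<sigma>] by simp
  then obtain e where e: "set e \<subseteq> carrier M \<times> carrier M" and \<sigma>_one: "\<sigma> \<one>\<^bsub>M\<^esub> = tensor_list N ?A ?B e"
    by (rule tensor_list_surj) simp
  have "separability_element N M f e"
  proof
    show "set e \<subseteq> carrier M \<times> carrier M" by (rule e)
    show "pair_sum M (\<lambda>c d. c \<otimes>\<^bsub>M\<^esub> d) e = \<one>\<^bsub>M\<^esub>"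
      using mult_map_tensor_list[OF TM S.ring_axioms _ e] bspec[OF mult S.one_closed] \<sigma>_one by simp
  next
    fix x b assume x: "x \<in> carrier M" and b: "ring_balanced N M f b"
    let ?l = "map (\<lambda>(a, c). (x \<otimes>\<^bsub>M\<^esub> a, c)) e" and ?r = "map (\<lambda>(a, c). (a, c \<otimes>\<^bsub>M\<^esub> x)) e"
    \<comment> \<open>Both multiples of \<open>e\<close> by \<open>x\<close> equal
      \<open>\<sigma> x\<close>, by left and right linearity respectively.\<close>
    have "tensor_list N ?A ?B ?l = \<sigma> x"
      using bimod_hom_lact[OF \<sigma> x, of "\<one>\<^bsub>M\<^esub>"] lact_tensor_list[OF x, of e] e x by (simp add: \<sigma>_one)
    moreover have "tensor_list N ?A ?B ?r = \<sigma> x"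
      using bimod_hom_ract[OF \<sigma> x, of "\<one>\<^bsub>M\<^esub>"] ract_tensor_list[OF x, of e] e x by (simp add: \<sigma>_one)
    moreover have "set ?l \<subseteq> carrier M \<times> carrier M" "set ?r \<subseteq> carrier M \<times> carrier M"
      using e x by auto
    ultimately have "pair_sum M b ?l = pair_sum M b ?r"
      using b by (intro pair_sum_eq_if_tensor_list_eq) (simp_all add: balanced_ring_bimod S.abelian_group_axioms)
    then show "pair_sum M (\<lambda>c d. b (x \<otimes>\<^bsub>M\<^esub> c) d) e = pair_sum M (\<lambda>c d. b c (d \<otimes>\<^bsub>M\<^esub> x)) e"
      by (simp add: case_prod_beta)
  qed
  then show thesis by (rule that)
qed

lemma separability_element_op:
  assumes "separability_element N M f e"
  shows "separability_element (op_ring N) (op_ring M) f (map prod.swap e)"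
proof -
  interpret separability_element N M f e by fact
  show ?thesis
  proof (intro separability_element.intro ring_hom_ring_op ring_hom_ring_axioms
      separability_element_axioms.intro, goal_cases)
    case 1 then show ?case using e_carrier by fastforce
  next
    case (2 x b)
    then show ?case using e_comm[of x "\<lambda>x y. b y x"] by (simp add: ring_balanced_op)
  next
    case 3 show ?case using e_one by simp
  qed
qed

lemma bimod_sum_simps:
  "carrier (bimod_sum A B) = carrier A \<times> carrier B"
  "p \<oplus>\<^bsub>bimod_sum A B\<^esub> q = (fst p \<oplus>\<^bsub>A\<^esub> fst q, snd p \<oplus>\<^bsub>B\<^esub> snd q)"
  "lact (bimod_sum A B) r p = (lact A r (fst p), lact B r (snd p))"
  "ract (bimod_sum A B) p s = (ract A (fst p) s, ract B (snd p) s)"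
  by (simp_all add: bimod_sum_def case_prod_beta)

text \<open>\<open>E\<close> is the first component of the given isomorphism, and \<open>z\<close>
  is the preimage of the unit of \<open>N\<close> paired with zero.\<close>

lemma split_projection_if_split:
  fixes N :: "('n, 'k) ring_scheme" and M :: "('m, 'l) ring_scheme"
  assumes hom: "ring_hom_ring N M f" and split: "split_extension N M f"
  obtains E z where "split_projection N M f E z"
proof -
  interpret ring_hom_ring N M f by fact
  obtain V :: "('n, 'n, 'm) bimod" and h where V: "bimodule N N V"
    and h: "h \<in> bimod_hom N N (ring_bimod M f f) (bimod_sum (ring_bimod N id id) V)"
    and bij: "bij_betw h (carrier M) (carrier N \<times> carrier V)"
    using split unfolding split_extension_def bimod_isomorphic_def bimod_sum_simps ring_bimod_simps
    by blast
  interpret V: bimodule N N V by fact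
  have h_closed: "h x \<in> carrier N \<times> carrier V"
    and h_add: "y \<in> carrier M \<Longrightarrow> h (x \<oplus>\<^bsub>M\<^esub> y) = (fst (h x) \<oplus>\<^bsub>N\<^esub> fst (h y), snd (h x) \<oplus>\<^bsub>V\<^esub> snd (h y))"
    and h_left: "r \<in> carrier N \<Longrightarrow> h (f r \<otimes>\<^bsub>M\<^esub> x) = (r \<otimes>\<^bsub>N\<^esub> fst (h x), lact V r (snd (h x)))"
    and h_right: "r \<in> carrier N \<Longrightarrow> h (x \<otimes>\<^bsub>M\<^esub> f r) = (fst (h x) \<otimes>\<^bsub>N\<^esub> r, ract V (snd (h x)) r)"
    if "x \<in> carrier M" for x y r
    using that h[unfolded bimod_hom_iff bimod_sum_simps ring_bimod_simps] by simp_all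
  have "(\<one>\<^bsub>N\<^esub>, \<zero>\<^bsub>V\<^esub>) \<in> h ` carrier M"
    using bij by (simp add: bij_betw_def)
  then obtain z where z: "z \<in> carrier M" "h z = (\<one>\<^bsub>N\<^esub>, \<zero>\<^bsub>V\<^esub>)"
    by (metis imageE)
  \<comment> \<open>Both sides have image \<open>r\<close> paired with zero, and \<open>h\<close> is
    injective.\<close>
  have "f r \<otimes>\<^bsub>M\<^esub> z = z \<otimes>\<^bsub>M\<^esub> f r" if r: "r \<in> carrier N" for r
  proof (rule inj_onD[OF bij_betw_imp_inj_on[OF bij]])
    show "h (f r \<otimes>\<^bsub>M\<^esub> z) = h (z \<otimes>\<^bsub>M\<^esub> f r)"
      using r z by (simp add: h_left h_right V.lact_zero_right V.ract_zero_left)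
  qed (use r z in simp_all)
  then have "split_projection N M f (\<lambda>x. fst (h x)) z"
    using h_closed by (intro split_projection.intro hom split_projection_axioms.intro)
      (simp_all add: h_add h_left h_right z mem_Times_iff)
  then show thesis by (rule that)
qed

lemma split_projection_op:
  assumes "split_projection N M f E z"
  shows "split_projection (op_ring N) (op_ring M) f E z"
proof -
  interpret split_projection N M f E z by fact
  show ?thesis
    by (intro split_projection.intro ring_hom_ring_op ring_hom_ring_axioms split_projection_axioms.intro)
      (simp_all add: E_closed E_add E_left E_right z_closed z_comm E_z)
qed

text \<open>The pairs of indices below \<open>k\<close> are listed by \<open>List.product\<close>,
  which accounts for the \<open>k * k\<close> copies; the sum condition is
  \<open>V_U_identity\<close> read pointwise.\<close>

lemma (in left_QF_data) bimod_summand_right_dual: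
  "bimod_summand N M Mdual (copies {..<k * k} (ring_bimod M f id))"
proof -
  let ?ps = "map (\<lambda>(i, l). (U i l, V i l)) (List.product [0..<k] [0..<k])"
  have A: "bimodule N M Mdual"
    by (intro bimodule_right_dual bimodule_ring_bimod ring_hom_ring_id S.ring_axioms ring_hom_ring_axioms)
  interpret D: bimodule N M Mdual by (rule A)
  have VU: "V i l (U i l \<phi>) \<in> carrier Mdual" if "\<phi> \<in> carrier Mdual" "i < k" "l < k" for i l \<phi>
    by (rule V_in_dual[OF that(2,3) U_closed[OF that(2,3,1)]])
  have "bimod_summand N M Mdual (copies {..<length ?ps} (ring_bimod M f id))"
  proof (rule bimod_summand_copiesI[OF A])
    show "bimodule N M (ring_bimod M f id)"
      by (intro bimodule_ring_bimod ring_hom_ring_id S.ring_axioms ring_hom_ring_axioms)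
    show "fst p \<in> bimod_hom N M Mdual (ring_bimod M f id)" if "p \<in> set ?ps" for p
      using that U_bimod_hom by auto
    show "snd p \<in> bimod_hom N M (ring_bimod M f id) Mdual" if "p \<in> set ?ps" for p
      using that V_bimod_hom by auto
    show "list_sum Mdual (\<lambda>p. snd p (fst p \<phi>)) ?ps = \<phi>" (is "?\<psi> = \<phi>")
      if \<phi>: "\<phi> \<in> carrier Mdual" for \<phi>
    proof (rule extensionalityI)
      have closed: "snd p (fst p \<phi>) \<in> carrier Mdual" if "p \<in> set ?ps" for p
        using that VU[OF \<phi>] by auto
      have "?\<psi> \<in> carrier Mdual"
        by (rule D.list_sum_closed[OF closed])
      then show "?\<psi> \<in> extensional (carrier M)" "\<phi> \<in> extensional (carrier M)"
        using \<phi> by (simp_all add: carrier_Mdual_iff)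
      fix x assume x: "x \<in> carrier M"
      \<comment> \<open>Evaluation at \<open>x\<close> is additive on the dual, so the sum of
        functionals becomes a sum in \<open>N\<close>.\<close>
      have "?\<psi> x = list_sum N (\<lambda>p. snd p (fst p \<phi>) x) ?ps"
        by (rule D.hom_list_sum[where g = "\<lambda>\<phi>. \<phi> x"])
          (use x closed in \<open>simp_all add: R.abelian_group_axioms del: set_map\<close>)
      also have "\<dots> = list_sum N (\<lambda>i. list_sum N (\<lambda>l. V i l (U i l \<phi>) x) [0..<k]) [0..<k]"
        using Mdual_closed[OF VU[OF \<phi>] x]
        by (simp add: case_prod_beta) (subst R.list_sum_product; simp)
      also have "\<dots> = \<phi> x"
        by (rule V_U_identity[OF \<phi> x])
      finally show "?\<psi> x = \<phi> x" .
    qed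
  qed
  then show ?thesis by simp
qed

section \<open>Passage to opposite rings\<close>

text \<open>Exchanging the two actions turns a bimodule over \<open>R\<close> and \<open>S\<close>
  into one over the opposites of \<open>S\<close> and \<open>R\<close>.\<close>

definition bimod_op :: "('r, 's, 'a) bimod \<Rightarrow> ('s, 'r, 'a) bimod" where
  "bimod_op A = \<lparr>carrier = carrier A, mult = mult A, one = one A, zero = zero A, add = add A,
     lact = (\<lambda>s x. ract A x s), ract = (\<lambda>x r. lact A r x)\<rparr>"

lemma bimod_op_simps [simp]:
  "carrier (bimod_op A) = carrier A" "\<zero>\<^bsub>bimod_op A\<^esub> = \<zero>\<^bsub>A\<^esub>" "x \<oplus>\<^bsub>bimod_op A\<^esub> y = x \<oplus>\<^bsub>A\<^esub> y"
  "lact (bimod_op A) s x = ract A x s" "ract (bimod_op A) x r = lact A r x"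
  by (simp_all add: bimod_op_def)

lemma sub_bimodule_op: "sub_bimodule (op_ring S) (op_ring R) P (bimod_op B) \<longleftrightarrow> sub_bimodule R S P B"
proof -
  have "additive_subgroup P (bimod_op B) \<longleftrightarrow> additive_subgroup P B"
    by (simp add: additive_subgroup_def subgroup_def m_inv_def)
  then show ?thesis
    by (auto simp: sub_bimodule_def left_submodule_def right_submodule_def)
qed

lemma bimod_summand_op:
  "bimod_summand (op_ring S) (op_ring R) (bimod_op A) (bimod_op B) \<longleftrightarrow> bimod_summand R S A B"
proof -
  have "internal_sum (bimod_op B) P Q \<longleftrightarrow> internal_sum B P Q" for P Q
    by (simp add: internal_sum_def set_add_def set_mult_def)
  moreover have "h \<in> bimod_hom (op_ring S) (op_ring R) (bimod_op A) (bimod_op B) \<longleftrightarrow>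
      h \<in> bimod_hom R S A B" for h
    by (auto simp: bimod_hom_iff)
  ultimately show ?thesis
    by (simp add: bimod_summand_def sub_bimodule_op Bex_def)
qed

text \<open>An equality of records, not merely an isomorphism, so the conclusion over the opposite
  rings can be rewritten directly. The same holds for \<open>copies_op\<close>.\<close>

lemma right_dual_op:
  "right_dual (op_ring N) (ring_bimod (op_ring M) id f) = bimod_op (left_dual N (ring_bimod M f id))"
  by (simp add: right_dual_def left_dual_def bimod_op_def ring_bimod_def right_hom_def left_hom_def hom_def)

lemma copies_op: "copies I (ring_bimod (op_ring M) f id) = bimod_op (copies I (ring_bimod M id f))"
  by (simp add: copies_def bimod_op_def ring_bimod_def)

theorem theorem7p4:
  fixes N :: "('n, 'k) ring_scheme" and M :: "('m, 'l) ring_scheme" and f :: "'n \<Rightarrow> 'm"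
  assumes "ring_hom_ring N M f"
    and "biseparable N M f"
    and "depth_two N M f"
  shows "QF_extension N M f"
proof -
  have fgp: "fgp_extension N M f" and sep: "separable_extension N M f" and split: "split_extension N M f"
    using assms(2) by (simp_all add: biseparable_def)
  obtain e where e: "separability_element N M f e"
    using separability_element_if_separable[OF assms(1) sep] .
  obtain E z where Ez: "split_projection N M f E z"
    using split_projection_if_split[OF assms(1) split] .
  obtain k t \<beta> where k: "k \<ge> 1" and \<beta>: "left_quasibase N M f k t \<beta>"
    using left_quasibase_if_left_D2[OF assms(1)] assms(3) unfolding depth_two_def by metis
  have "left_QF_data N M f k t \<beta> e E z"
    by (intro left_QF_data.intro e Ez \<beta>)
  from left_QF_data.bimod_summand_right_dual[OF this]
  have "left_QF N M f"
    using fgp k unfolding left_QF_def by (intro conjI exI[of _ "k * k"]) simp_all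
  obtain k' t' \<gamma> where k': "k' \<ge> 1" and \<gamma>: "left_quasibase (op_ring N) (op_ring M) f k' t' \<gamma>"
    using left_quasibase_op_if_right_D2[OF assms(1)] assms(3) unfolding depth_two_def by metis
  \<comment> \<open>Separability and splitness are symmetric under passing to opposite rings, while
    right depth two supplies the left quasibase there.\<close>
  have "left_QF_data (op_ring N) (op_ring M) f k' t' \<gamma> (map prod.swap e) E z"
    by (intro left_QF_data.intro separability_element_op e split_projection_op Ez \<gamma>)
  from left_QF_data.bimod_summand_right_dual[OF this]
  \<comment> \<open>Over the opposite rings the right dual is the left dual over \<open>N\<close>
    with its actions exchanged, so the left-hand statement there is the right-hand one here.\<close>
  have "bimod_summand M N (left_dual N (ring_bimod M f id)) (copies {..<k' * k'} (ring_bimod M id f))"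
    by (simp only: right_dual_op copies_op bimod_summand_op)
  then have "right_QF N M f"
    using fgp k' unfolding right_QF_def by (intro conjI exI[of _ "k' * k'"]) simp_all
  with \<open>left_QF N M f\<close> show ?thesis
    by (simp add: QF_extension_def)
qed

end
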